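(* Let $\mathbf{X}_n$ and $\mathbf{Y}_n$ ($2\le n\le \omega$) be the skew lattices described in the context. (1) A left-handed skew lattice is categorical if and only if, for every $n$ with $2\le n\le\omega$, it contains no subalgebra isomorphic to $\mathbf{X}_n$. (2) A right-handed skew lattice is categorical if and only if, for every $n$ with $2\le n\le\omega$, it contains no subalgebra isomorphic to $\mathbf{Y}_n$. (3) An arbitrary skew lattice is categorical if and only if it contains no subalgebra isomorphic to any of the algebras $\mathbf{X}_n$ or $\mathbf{Y}_n$ with $2\le n\le\omega$. (4) None of the algebras $\mathbf{X}_n$, $\mathbf{Y}_n$ ($2\le n\le\omega$) is (isomorphic to) a subalgebra of another one of them.
   Context: A skew lattice is an algebra $(S;\lor,\land)$ where $\lor,\land$ are associative idempotent binary operations satisfying $x\land(x\lor y)=x=(y\lor x)\land x$ and $x\lor(x\land y)=x=(y\land x)\lor x$. The natural preorder is $x\succeq y$ iff $x\lor y\lor x=x$ (equivalently $y\land x\land y=y$), and $x\,\mathcal{D}\,y$ means $x\succeq y\succeq x$; $\mathcal{D}$ is a congruence and $\mathbf{S}/\mathcal{D}$ is a lattice. The natural partial order is $x\ge y$ iff $x\lor y=x=y\lor x$ (equivalently $x\land y=y=y\land x$); $x>y$ means $x\ge y$, $x\ne y$. A skew lattice is left-handed if $x\land y\land x=x\land y$ and $x\lor y\lor x=y\lor x$ hold identically, and right-handed if $x\land y\land x=y\land x$ and $x\lor y\lor x=x\lor y$ hold identically. Cosets: for $\mathcal{D}$-classes $A>B$ (in the order of the lattice $\mathbf{S}/\mathcal{D}$),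 an $A$-coset in $B$ is a set $A\land b\land A=\{a\land b\land a' : a,a'\in A\}$ with $b\in B$; a $B$-coset in $A$ is a set $B\lor a\lor B=\{b\lor a\lor b' : b,b'\in B\}$ with $a\in A$. Cosets of either kind partition the class containing them. For a $B$-coset $X$ in $A$ and an $A$-coset $Y$ in $B$, the coset bijection $X\to Y$ is the bijection $\{(a,b)\in X\times Y : a>b\}$; it is regarded as a partial bijection $A\to B$. A three-term skew chain of $\mathcal{D}$-classes is $A>B>C$ in $\mathbf{S}/\mathcal{D}$. It is categorical if for all coset bijections $\varphi:A\to B$ and $\psi:B\to C$ the composite partial bijection $\psi\circ\varphi$, if nonempty, is a coset bijection from $A$ to $C$. A skew lattice is categorical if all of its skew chains $A>B>C$ are categorical. The algebras $\mathbf{X}_n$: $\mathbf{X}_n$ is the left-handed skew lattice with underlying set the disjoint union $A\cup B_n\cup C$ and $\mathcal{D}$-classes $A>B_n>C$, where $A=\{a_1,a_2\}$, $C=\{c_1,c_2\}$, $B_n=\{b_1,\dots,b_{2n}\}$ for finite $n$ and $B_\omega=\{b_i : i\in\mathbb{Z}\}$ (all listed elements distinct). The strict natural partial order is $a_1>b_i>c_1$ for $i$ odd, $a_2>b_i>c_2$ for $i$ even, together with $a_1>c_1$ and $a_2>c_2$. Cosets: $A$ is a single $B_n$-coset and a single $C$-coset in itself; $C$ is a single $B_n$-coset and a single $A$-coset in itself; the $A$-cosets in $B_n$ are the sets $\{b_{2k-1},b_{2k}\}$; the $C$-cosets in $B_n$ are the sets $\{b_{2k},b_{2k+1}\}$,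 with indices read modulo $2n$ when $n$ is finite (so that $\{b_{2n},b_1\}$ is one of them). Operations: if $p,q$ lie in the same $\mathcal{D}$-class, then $p\land q=p$ and $p\lor q=q$. If $p\in P$, $q\in Q$ with $P>Q$ two of the three classes, then $p\land q$ is the unique $q'$ in the $P$-coset of $q$ in $Q$ with $p>q'$, $q\land p=q$, $p\lor q$ is the unique $p'$ in the $Q$-coset of $p$ in $P$ with $p'>q$, and $q\lor p=p$. The algebra $\mathbf{Y}_n$ is the right-handed dual of $\mathbf{X}_n$: the same set with operations $x\land' y=y\land x$ and $x\lor' y=y\lor x$. *)

theory Defs
  imports Main "HOL-Library.Extended_Nat"
begin

section \<open>Skew lattices\<close>

record 'a skew_alg =
  carrier :: "'a set"
  join :: "'a \<Rightarrow> 'a \<Rightarrow> 'a" (infixl "\<squnion>\<index>" 65)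
  meet :: "'a \<Rightarrow> 'a \<Rightarrow> 'a" (infixl "\<sqinter>\<index>" 70)

locale skew_lattice =
  fixes S :: "('a, 'm) skew_alg_scheme" (structure)
  assumes join_closed: "x \<in> carrier S \<Longrightarrow> y \<in> carrier S \<Longrightarrow> x \<squnion> y \<in> carrier S"
    and meet_closed: "x \<in> carrier S \<Longrightarrow> y \<in> carrier S \<Longrightarrow> x \<sqinter> y \<in> carrier S"
    and join_assoc: "x \<in> carrier S \<Longrightarrow> y \<in> carrier S \<Longrightarrow> z \<in> carrier S
      \<Longrightarrow> (x \<squnion> y) \<squnion> z = x \<squnion> (y \<squnion> z)"
    and meet_assoc: "x \<in> carrier S \<Longrightarrow> y \<in> carrier S \<Longrightarrow> z \<in> carrier S
      \<Longrightarrow> (x \<sqinter> y) \<sqinter> z = x \<sqinter> (y \<sqinter> z)"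
    and join_idem: "x \<in> carrier S \<Longrightarrow> x \<squnion> x = x"
    and meet_idem: "x \<in> carrier S \<Longrightarrow> x \<sqinter> x = x"
    and absorb_meet_left: "x \<in> carrier S \<Longrightarrow> y \<in> carrier S \<Longrightarrow> x \<sqinter> (x \<squnion> y) = x"
    and absorb_meet_right: "x \<in> carrier S \<Longrightarrow> y \<in> carrier S \<Longrightarrow> (y \<squnion> x) \<sqinter> x = x"
    and absorb_join_left: "x \<in> carrier S \<Longrightarrow> y \<in> carrier S \<Longrightarrow> x \<squnion> (x \<sqinter> y) = x"
    and absorb_join_right: "x \<in> carrier S \<Longrightarrow> y \<in> carrier S \<Longrightarrow> (y \<sqinter> x) \<squnion> x = x"

locale left_handed_skew_lattice = skew_lattice +
  assumes left_handed_meet: "x \<in> carrier S \<Longrightarrow> y \<in> carrier S \<Longrightarrow> x \<sqinter> y \<sqinter> x = x \<sqinter> y"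
    and left_handed_join: "x \<in> carrier S \<Longrightarrow> y \<in> carrier S \<Longrightarrow> x \<squnion> y \<squnion> x = y \<squnion> x"

locale right_handed_skew_lattice = skew_lattice +
  assumes right_handed_meet: "x \<in> carrier S \<Longrightarrow> y \<in> carrier S \<Longrightarrow> x \<sqinter> y \<sqinter> x = y \<sqinter> x"
    and right_handed_join: "x \<in> carrier S \<Longrightarrow> y \<in> carrier S \<Longrightarrow> x \<squnion> y \<squnion> x = x \<squnion> y"

definition nat_preorder :: "('a, 'm) skew_alg_scheme \<Rightarrow> 'a \<Rightarrow> 'a \<Rightarrow> bool" where
  "nat_preorder S x y \<longleftrightarrow> x \<squnion>\<^bsub>S\<^esub> y \<squnion>\<^bsub>S\<^esub> x = x"

definition nat_ge :: "('a, 'm) skew_alg_scheme \<Rightarrow> 'a \<Rightarrow> 'a \<Rightarrow> bool" where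
  "nat_ge S x y \<longleftrightarrow> x \<squnion>\<^bsub>S\<^esub> y = x \<and> y \<squnion>\<^bsub>S\<^esub> x = x"

definition nat_gt :: "('a, 'm) skew_alg_scheme \<Rightarrow> 'a \<Rightarrow> 'a \<Rightarrow> bool" where
  "nat_gt S x y \<longleftrightarrow> nat_ge S x y \<and> x \<noteq> y"

definition Drel :: "('a, 'm) skew_alg_scheme \<Rightarrow> ('a \<times> 'a) set" where
  "Drel S = {(x, y) \<in> carrier S \<times> carrier S. nat_preorder S x y \<and> nat_preorder S y x}"

definition Dclasses :: "('a, 'm) skew_alg_scheme \<Rightarrow> 'a set set" where
  "Dclasses S = carrier S // Drel S"

text \<open>The meet operation and the strict order of the quotient lattice of \<open>S\<close> modulo \<open>Drel S\<close>.\<close>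

definition Dmeet :: "('a, 'm) skew_alg_scheme \<Rightarrow> 'a set \<Rightarrow> 'a set \<Rightarrow> 'a set" where
  "Dmeet S A B = (\<Union>a\<in>A. \<Union>b\<in>B. Drel S `` {a \<sqinter>\<^bsub>S\<^esub> b})"

definition Dgt :: "('a, 'm) skew_alg_scheme \<Rightarrow> 'a set \<Rightarrow> 'a set \<Rightarrow> bool" where
  "Dgt S A B \<longleftrightarrow> Dmeet S A B = B \<and> A \<noteq> B"


section \<open>Cosets and categorical skew lattices\<close>

text \<open>For \<open>A\<close> above \<open>B\<close>: \<open>lower_cosets S A B\<close> are the \<open>A\<close>-cosets in \<open>B\<close>, and
  \<open>upper_cosets S A B\<close> are the \<open>B\<close>-cosets in \<open>A\<close>.\<close>

definition lower_cosets :: "('a, 'm) skew_alg_scheme \<Rightarrow> 'a set \<Rightarrow> 'a set \<Rightarrow> 'a set set" where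
  "lower_cosets S A B =
    (\<lambda>b. {a \<sqinter>\<^bsub>S\<^esub> b \<sqinter>\<^bsub>S\<^esub> a' | a a'. a \<in> A \<and> a' \<in> A}) ` B"

definition upper_cosets :: "('a, 'm) skew_alg_scheme \<Rightarrow> 'a set \<Rightarrow> 'a set \<Rightarrow> 'a set set" where
  "upper_cosets S A B =
    (\<lambda>a. {b \<squnion>\<^bsub>S\<^esub> a \<squnion>\<^bsub>S\<^esub> b' | b b'. b \<in> B \<and> b' \<in> B}) ` A"

text \<open>Partial bijections are represented by their graphs, so that \<open>\<psi> \<circ> \<phi>\<close> is the relational
  composition \<open>\<phi> O \<psi>\<close>.\<close>

definition coset_bijections ::
    "('a, 'm) skew_alg_scheme \<Rightarrow> 'a set \<Rightarrow> 'a set \<Rightarrow> ('a \<times> 'a) set set" where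
  "coset_bijections S A B =
    {{(a, b) \<in> X \<times> Y. nat_gt S a b} | X Y. X \<in> upper_cosets S A B \<and> Y \<in> lower_cosets S A B}"

definition categorical_chain ::
    "('a, 'm) skew_alg_scheme \<Rightarrow> 'a set \<Rightarrow> 'a set \<Rightarrow> 'a set \<Rightarrow> bool" where
  "categorical_chain S A B C \<longleftrightarrow>
    (\<forall>\<phi> \<in> coset_bijections S A B. \<forall>\<psi> \<in> coset_bijections S B C.
      \<phi> O \<psi> \<noteq> {} \<longrightarrow> \<phi> O \<psi> \<in> coset_bijections S A C)"

definition categorical :: "('a, 'm) skew_alg_scheme \<Rightarrow> bool" where
  "categorical S \<longleftrightarrow>
    (\<forall>A \<in> Dclasses S. \<forall>B \<in> Dclasses S. \<forall>C \<in> Dclasses S.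
      Dgt S A B \<and> Dgt S B C \<longrightarrow> categorical_chain S A B C)"


section \<open>Subalgebras and isomorphisms\<close>

definition subalgebra :: "'a set \<Rightarrow> ('a, 'm) skew_alg_scheme \<Rightarrow> bool" where
  "subalgebra T S \<longleftrightarrow> T \<subseteq> carrier S \<and>
    (\<forall>x \<in> T. \<forall>y \<in> T. x \<squnion>\<^bsub>S\<^esub> y \<in> T \<and> x \<sqinter>\<^bsub>S\<^esub> y \<in> T)"

definition isomorphic :: "('a, 'm) skew_alg_scheme \<Rightarrow> ('b, 'k) skew_alg_scheme \<Rightarrow> bool" where
  "isomorphic S T \<longleftrightarrow> (\<exists>h. bij_betw h (carrier S) (carrier T) \<and>
    (\<forall>x \<in> carrier S. \<forall>y \<in> carrier S.
      h (x \<squnion>\<^bsub>S\<^esub> y) = h x \<squnion>\<^bsub>T\<^esub> h y \<and> h (x \<sqinter>\<^bsub>S\<^esub> y) = h x \<sqinter>\<^bsub>T\<^esub> h y))"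

definition has_subalgebra_iso ::
    "('a, 'm) skew_alg_scheme \<Rightarrow> ('b, 'k) skew_alg_scheme \<Rightarrow> bool" where
  "has_subalgebra_iso S X \<longleftrightarrow> (\<exists>T. subalgebra T S \<and> isomorphic (S\<lparr>carrier := T\<rparr>) X)"


section \<open>The algebras \<open>X\<^sub>n\<close> and \<open>Y\<^sub>n\<close>\<close>

text \<open>The index \<open>n\<close> ranges over \<^typ>\<open>enat\<close>, with \<open>\<infinity>\<close> in the role of \<open>\<omega>\<close>.\<close>

datatype xelem = Xa1 | Xa2 | Xb int | Xc1 | Xc2

datatype xclass = ClassA | ClassB | ClassC

fun class_of :: "xelem \<Rightarrow> xclass" where
  "class_of Xa1 = ClassA"
| "class_of Xa2 = ClassA"
| "class_of (Xb i) = ClassB"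
| "class_of Xc1 = ClassC"
| "class_of Xc2 = ClassC"

fun class_gt :: "xclass \<Rightarrow> xclass \<Rightarrow> bool" where
  "class_gt ClassA ClassB = True"
| "class_gt ClassA ClassC = True"
| "class_gt ClassB ClassC = True"
| "class_gt _ _ = False"

fun X_B :: "enat \<Rightarrow> xelem set" where
  "X_B (enat n) = Xb ` {1..2 * int n}"
| "X_B \<infinity> = range Xb"

text \<open>The element \<open>b\<^sub>i\<close>; for finite \<open>n\<close> the index is reduced modulo \<open>2n\<close> into
  \<open>{1..2n}\<close>.\<close>

fun b_elem :: "enat \<Rightarrow> int \<Rightarrow> xelem" where
  "b_elem (enat n) i = Xb ((i - 1) mod (2 * int n) + 1)"
| "b_elem \<infinity> i = Xb i"

fun X_gt :: "xelem \<Rightarrow> xelem \<Rightarrow> bool" where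
  "X_gt Xa1 (Xb i) = odd i"
| "X_gt Xa2 (Xb i) = even i"
| "X_gt (Xb i) Xc1 = odd i"
| "X_gt (Xb i) Xc2 = even i"
| "X_gt Xa1 Xc1 = True"
| "X_gt Xa2 Xc2 = True"
| "X_gt _ _ = False"

text \<open>\<open>X_cosets n P Q\<close> is the set of \<open>P\<close>-cosets in \<open>Q\<close>; it is only used for \<open>P \<noteq> Q\<close>.\<close>

fun X_cosets :: "enat \<Rightarrow> xclass \<Rightarrow> xclass \<Rightarrow> xelem set set" where
  "X_cosets n ClassB ClassA = {{Xa1, Xa2}}"
| "X_cosets n ClassC ClassA = {{Xa1, Xa2}}"
| "X_cosets n ClassB ClassC = {{Xc1, Xc2}}"
| "X_cosets n ClassA ClassC = {{Xc1, Xc2}}"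
| "X_cosets n ClassA ClassB = {{b_elem n (2 * k - 1), b_elem n (2 * k)} | k. True}"
| "X_cosets n ClassC ClassB = {{b_elem n (2 * k), b_elem n (2 * k + 1)} | k. True}"
| "X_cosets n _ _ = {}"

definition X_meet :: "enat \<Rightarrow> xelem \<Rightarrow> xelem \<Rightarrow> xelem" where
  "X_meet n x y =
    (if class_gt (class_of x) (class_of y)
     then THE y'. (\<exists>Y \<in> X_cosets n (class_of x) (class_of y). y \<in> Y \<and> y' \<in> Y) \<and> X_gt x y'
     else x)"

definition X_join :: "enat \<Rightarrow> xelem \<Rightarrow> xelem \<Rightarrow> xelem" where
  "X_join n x y =
    (if class_gt (class_of x) (class_of y)
     then THE x'. (\<exists>X \<in> X_cosets n (class_of y) (class_of x). x \<in> X \<and> x' \<in> X) \<and> X_gt x' y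
     else y)"

definition X_alg :: "enat \<Rightarrow> xelem skew_alg" where
  "X_alg n = \<lparr>carrier = {Xa1, Xa2} \<union> X_B n \<union> {Xc1, Xc2}, join = X_join n, meet = X_meet n\<rparr>"

definition Y_alg :: "enat \<Rightarrow> xelem skew_alg" where
  "Y_alg n = \<lparr>carrier = carrier (X_alg n),
    join = (\<lambda>x y. y \<squnion>\<^bsub>X_alg n\<^esub> x), meet = (\<lambda>x y. y \<sqinter>\<^bsub>X_alg n\<^esub> x)\<rparr>"

end

theory Submission imports Defs begin

text \<open>
  For \<open>a \<ge> b \<ge> c\<close> and another pair \<open>a' \<ge> c'\<close> of the coset bijection through \<open>(a, c)\<close>, the composite
  of the coset bijections through \<open>(a, b)\<close> and \<open>(b, c)\<close> contains \<open>(a', c')\<close> exactly if the image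
  \<open>a' \<sqinter> b \<sqinter> a'\<close> of \<open>a'\<close> equals the preimage \<open>c' \<squnion> b \<squnion> c'\<close> of \<open>c'\<close>. So being not categorical amounts to
  the existence of elements \<open>a, b, c, a', c'\<close> satisfying certain equations and one inequation
  (\<open>bad_chain\<close>), a condition which is inherited from subalgebras and invariant under left-right duality,
  and which holds in \<open>X\<^sub>n\<close> for \<open>n \<ge> 2\<close>.

  Conversely, projecting a bad chain to the \<open>\<L>\<close>- or to the \<open>\<R>\<close>-classes of \<open>a, b, c\<close> keeps it bad, so
  up to duality \<open>a \<L> a'\<close> and \<open>c \<L> c'\<close>. Applying \<open>a' \<sqinter> _\<close> and \<open>_ \<squnion> c\<close> alternately to \<open>b\<close>, and their inverses
  \<open>a \<sqinter> _\<close> and \<open>_ \<squnion> c'\<close>, gives a sequence \<open>b\<^sub>i\<close>, \<open>i \<in> \<int>\<close>, which has no period \<open>2\<close> because the chain is bad.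
  Together with \<open>a, a', c, c'\<close> it is a copy of \<open>X\<^sub>n\<close>, where \<open>2n\<close> is the period.
\<close>

section \<open>Skew lattices and their duals\<close>

text \<open>The left-right dual: it fixes \<D> and the natural order and swaps \<L> with \<R>.
  Further record fields are dropped, so it is an involution on plain \<open>skew_alg\<close>
  records.\<close>

definition dual_alg :: "('a, 'm) skew_alg_scheme \<Rightarrow> 'a skew_alg" where
  "dual_alg S = \<lparr>carrier = carrier S,
    join = (\<lambda>x y. y \<squnion>\<^bsub>S\<^esub> x), meet = (\<lambda>x y. y \<sqinter>\<^bsub>S\<^esub> x)\<rparr>"

text \<open>The order dual: it reverses the natural preorder and partial order, so each fact about
  joins yields one about meets.\<close>

definition flip_alg :: "('a, 'm) skew_alg_scheme \<Rightarrow> 'a skew_alg" where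
  "flip_alg S = \<lparr>carrier = carrier S, join = meet S, meet = join S\<rparr>"

lemma dual_alg_simps [simp]:
  "carrier (dual_alg S) = carrier S"
  "x \<squnion>\<^bsub>dual_alg S\<^esub> y = y \<squnion>\<^bsub>S\<^esub> x"
  "x \<sqinter>\<^bsub>dual_alg S\<^esub> y = y \<sqinter>\<^bsub>S\<^esub> x"
  by (simp_all add: dual_alg_def)

lemma flip_alg_simps [simp]:
  "carrier (flip_alg S) = carrier S"
  "x \<squnion>\<^bsub>flip_alg S\<^esub> y = x \<sqinter>\<^bsub>S\<^esub> y"
  "x \<sqinter>\<^bsub>flip_alg S\<^esub> y = x \<squnion>\<^bsub>S\<^esub> y"
  by (simp_all add: flip_alg_def)

lemma dual_dual_alg: "dual_alg (dual_alg S) = (S :: 'a skew_alg)"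
  by (simp add: dual_alg_def)

lemma Y_alg_eq_dual: "Y_alg n = dual_alg (X_alg n)"
  by (simp add: Y_alg_def dual_alg_def)

definition bad_chain ::
    "('a, 'm) skew_alg_scheme \<Rightarrow> 'a \<Rightarrow> 'a \<Rightarrow> 'a \<Rightarrow> 'a \<Rightarrow> 'a \<Rightarrow> bool" where
  "bad_chain S a b c a' c' \<longleftrightarrow> {a, b, c, a', c'} \<subseteq> carrier S \<and> nat_ge S a b \<and> nat_ge S b c \<and>
    c' \<squnion>\<^bsub>S\<^esub> a \<squnion>\<^bsub>S\<^esub> c' = a' \<and> a' \<sqinter>\<^bsub>S\<^esub> c \<sqinter>\<^bsub>S\<^esub> a' = c' \<and>
    a' \<sqinter>\<^bsub>S\<^esub> b \<sqinter>\<^bsub>S\<^esub> a' \<noteq> c' \<squnion>\<^bsub>S\<^esub> b \<squnion>\<^bsub>S\<^esub> c'"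

text \<open>The first four meet equations say that \<open>a\<close>, \<open>a'\<close> and
  \<open>c\<close>, \<open>c'\<close> are \<L>-related; under them the sandwiches in
  \<open>bad_chain\<close> collapse to one-sided operations.\<close>

definition left_bad_chain ::
    "('a, 'm) skew_alg_scheme \<Rightarrow> 'a \<Rightarrow> 'a \<Rightarrow> 'a \<Rightarrow> 'a \<Rightarrow> 'a \<Rightarrow> bool" where
  "left_bad_chain S a b c a' c' \<longleftrightarrow> {a, b, c, a', c'} \<subseteq> carrier S \<and> nat_ge S a b \<and> nat_ge S b c \<and>
    a \<sqinter>\<^bsub>S\<^esub> a' = a \<and> a' \<sqinter>\<^bsub>S\<^esub> a = a' \<and> c \<sqinter>\<^bsub>S\<^esub> c' = c \<and> c' \<sqinter>\<^bsub>S\<^esub> c = c' \<and>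
    a \<squnion>\<^bsub>S\<^esub> c' = a' \<and> a' \<sqinter>\<^bsub>S\<^esub> c = c' \<and> a' \<sqinter>\<^bsub>S\<^esub> b \<noteq> b \<squnion>\<^bsub>S\<^esub> c'"

context skew_lattice
begin

lemmas [simp] = join_closed meet_closed join_idem meet_idem absorb_meet_left absorb_meet_right
  absorb_join_left absorb_join_right

lemma dual_skew_lattice: "skew_lattice (dual_alg S)"
  by unfold_locales (simp_all add: join_assoc meet_assoc)

lemma flip_skew_lattice: "skew_lattice (flip_alg S)"
  by unfold_locales (simp_all add: join_assoc meet_assoc)

lemma join_left_idem:
  "x \<in> carrier S \<Longrightarrow> y \<in> carrier S \<Longrightarrow> x \<squnion> (x \<squnion> y) = x \<squnion> y"
  by (simp add: join_assoc[symmetric])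

lemma meet_left_idem:
  "x \<in> carrier S \<Longrightarrow> y \<in> carrier S \<Longrightarrow> x \<sqinter> (x \<sqinter> y) = x \<sqinter> y"
  by (simp add: meet_assoc[symmetric])

section \<open>Natural order and preorder expressed by meets\<close>

lemma join_eq_right_iff:
  "x \<in> carrier S \<Longrightarrow> y \<in> carrier S \<Longrightarrow> x \<squnion> y = y \<longleftrightarrow> x \<sqinter> y = x"
  by (metis absorb_join_right absorb_meet_left)

lemma join_eq_left_iff:
  "x \<in> carrier S \<Longrightarrow> y \<in> carrier S \<Longrightarrow> x \<squnion> y = x \<longleftrightarrow> x \<sqinter> y = y"
  by (metis absorb_join_left absorb_meet_right)

lemma nat_ge_iff_meet:
  "x \<in> carrier S \<Longrightarrow> y \<in> carrier S \<Longrightarrow> nat_ge S x y \<longleftrightarrow> x \<sqinter> y = y \<and> y \<sqinter> x = y"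
  by (simp add: nat_ge_def join_eq_right_iff join_eq_left_iff)

lemma join_absorb_meet:
  assumes "x \<in> carrier S" "y \<in> carrier S" "x \<squnion> y \<squnion> x = x"
  shows "x \<sqinter> (y \<squnion> x) = y \<squnion> x" "(x \<squnion> y) \<sqinter> x = x \<squnion> y"
  using assms join_eq_left_iff[of x "y \<squnion> x"] join_eq_right_iff[of "x \<squnion> y" x]
  by (simp_all add: join_assoc)

text \<open>Absorption gives \<open>y = y \<sqinter> (y \<squnion> x)\<close>, and here
  \<open>y \<squnion> x = x \<sqinter> (y \<squnion> x)\<close>. So \<open>y\<close> has the
  idempotent \<open>y \<sqinter> x\<close> as a left factor and is fixed by it.\<close>

lemma nat_preorder_imp_meet:
  assumes [simp]: "x \<in> carrier S" "y \<in> carrier S" and "nat_preorder S x y"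
  shows "y \<sqinter> x \<sqinter> y = y"
proof -
  have "x \<sqinter> (y \<squnion> x) = y \<squnion> x"
    using assms by (auto simp: nat_preorder_def intro: join_absorb_meet)
  then have y: "y = y \<sqinter> x \<sqinter> (y \<squnion> x)"
    using absorb_meet_left[of y x] by (simp add: meet_assoc)
  have "y \<sqinter> x \<sqinter> y = y \<sqinter> x \<sqinter> (y \<sqinter> x \<sqinter> (y \<squnion> x))"
    using y by simp
  also have "\<dots> = y"
    using y meet_left_idem[of "y \<sqinter> x" "y \<squnion> x"] by simp
  finally show ?thesis .
qed

lemma nat_preorder_iff_meet:
  assumes "x \<in> carrier S" "y \<in> carrier S"
  shows "nat_preorder S x y \<longleftrightarrow> y \<sqinter> x \<sqinter> y = y"
  using assms nat_preorder_imp_meet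
    skew_lattice.nat_preorder_imp_meet[OF flip_skew_lattice, of y x]
  by (auto simp: nat_preorder_def)

lemma nat_preorder_dual:
  assumes "x \<in> carrier S" "y \<in> carrier S"
  shows "nat_preorder (dual_alg S) x y \<longleftrightarrow> nat_preorder S x y"
  using assms by (simp add: nat_preorder_def join_assoc)

lemma nat_preorder_flip:
  assumes "x \<in> carrier S" "y \<in> carrier S"
  shows "nat_preorder (flip_alg S) x y \<longleftrightarrow> nat_preorder S y x"
  using nat_preorder_iff_meet[of y x] assms by (simp add: nat_preorder_def)

text \<open>A join lies above each of its factors: the join \<open>x\<close> absorbs
  \<open>y \<squnion> v\<close> on the right, and idempotence of \<open>x \<squnion> y\<close> then
  removes the inner \<open>y\<close>.\<close>

lemma nat_preorder_joinI:
  assumes [simp]: "u \<in> carrier S" "v \<in> carrier S" "y \<in> carrier S"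
  shows "nat_preorder S (u \<squnion> y \<squnion> v) y"
proof -
  define x where "x = u \<squnion> y \<squnion> v"
  have [simp]: "x \<in> carrier S" by (simp add: x_def)
  have *: "x \<squnion> (y \<squnion> v) = x"
    by (simp add: x_def join_assoc join_left_idem)
  have "x \<squnion> y \<squnion> x = x \<squnion> y \<squnion> (x \<squnion> (y \<squnion> v))" using * by simp
  also have "\<dots> = (x \<squnion> y) \<squnion> (x \<squnion> y) \<squnion> v" by (simp add: join_assoc del: join_idem)
  also have "\<dots> = x" using * by (simp add: join_assoc)
  finally show ?thesis by (simp add: nat_preorder_def x_def)
qed

lemma nat_preorder_meetI:
  assumes "u \<in> carrier S" "v \<in> carrier S" "x \<in> carrier S"
  shows "nat_preorder S x (u \<sqinter> x \<sqinter> v)"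
  using skew_lattice.nat_preorder_joinI[OF flip_skew_lattice, of u v x] assms
  by (simp add: nat_preorder_flip)

lemma nat_preorder_refl: "x \<in> carrier S \<Longrightarrow> nat_preorder S x x"
  by (simp add: nat_preorder_def)

lemma nat_preorder_trans:
  assumes "x \<in> carrier S" "y \<in> carrier S" "z \<in> carrier S"
    and "nat_preorder S x y" "nat_preorder S y z"
  shows "nat_preorder S x z"
proof -
  have "x = x \<squnion> (y \<squnion> z \<squnion> y) \<squnion> x"
    using assms by (simp add: nat_preorder_def)
  then have "x = (x \<squnion> y) \<squnion> z \<squnion> (y \<squnion> x)"
    using assms(1-3) by (simp add: join_assoc)
  then show ?thesis
    using nat_preorder_joinI[of "x \<squnion> y" "y \<squnion> x" z] assms(1-3) by simp
qed

lemma nat_ge_imp_preorder: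
  "x \<in> carrier S \<Longrightarrow> y \<in> carrier S \<Longrightarrow> nat_ge S x y \<Longrightarrow> nat_preorder S x y"
  by (simp add: nat_ge_def nat_preorder_def)

section \<open>The congruence \<D> and its rectangular classes\<close>

lemma Drel_carrier: "(x, y) \<in> Drel S \<Longrightarrow> x \<in> carrier S" "(x, y) \<in> Drel S \<Longrightarrow> y \<in> carrier S"
  by (auto simp: Drel_def)

lemma equiv_Drel: "equiv (carrier S) (Drel S)"
proof (rule equivI)
  show "Drel S \<subseteq> carrier S \<times> carrier S" by (auto simp: Drel_def)
  show "refl_on (carrier S) (Drel S)" by (auto simp: Drel_def refl_on_def nat_preorder_refl)
  show "sym (Drel S)" by (auto simp: Drel_def sym_def)
  show "trans (Drel S)" unfolding trans_def by (auto simp: Drel_def intro: nat_preorder_trans)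
qed

lemma Drel_refl: "x \<in> carrier S \<Longrightarrow> (x, x) \<in> Drel S"
  by (simp add: Drel_def nat_preorder_refl)

lemma Drel_sym: "(x, y) \<in> Drel S \<Longrightarrow> (y, x) \<in> Drel S"
  by (auto simp: Drel_def)

lemma Drel_trans: "(x, y) \<in> Drel S \<Longrightarrow> (y, z) \<in> Drel S \<Longrightarrow> (x, z) \<in> Drel S"
  using equiv_Drel by (meson equivE transD)

lemma Drel_dual: "Drel (dual_alg S) = Drel S"
  by (auto simp: Drel_def nat_preorder_dual)

lemma Drel_flip: "Drel (flip_alg S) = Drel S"
  by (auto simp: Drel_def nat_preorder_flip)

lemma Drel_joinI:
  assumes [simp]: "x \<in> carrier S" "y \<in> carrier S" and "nat_preorder S x y"
  shows "(x, x \<squnion> y) \<in> Drel S" "(x, y \<squnion> x) \<in> Drel S"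
  using assms nat_preorder_joinI[of x y x] nat_preorder_joinI[of y x x]
  by (auto simp: Drel_def nat_preorder_def join_assoc join_left_idem)

lemma Drel_meetI:
  assumes "x \<in> carrier S" "y \<in> carrier S" "nat_preorder S x y"
  shows "(y, x \<sqinter> y) \<in> Drel S" "(y, y \<sqinter> x) \<in> Drel S"
  using skew_lattice.Drel_joinI[OF flip_skew_lattice, of y x] assms
  by (auto simp: Drel_flip nat_preorder_flip)

lemma Drel_join_absorb: "(x, y) \<in> Drel S \<Longrightarrow> x \<squnion> y \<squnion> x = x"
  by (simp add: Drel_def nat_preorder_def)

lemma Drel_meet_absorb: "(x, y) \<in> Drel S \<Longrightarrow> x \<sqinter> y \<sqinter> x = x"
  by (auto simp: Drel_def nat_preorder_iff_meet)

text \<open>Each \<D>-class is a rectangular band. Expanding \<open>z\<close> to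
  \<open>z \<squnion> x \<squnion> z\<close> puts \<open>y \<squnion> z\<close>, which is
  \<D>-related to \<open>x\<close>, between two copies of \<open>x\<close>, where it is
  absorbed.\<close>

lemma Drel_join_rect:
  assumes "(x, y) \<in> Drel S" "(x, z) \<in> Drel S"
  shows "x \<squnion> y \<squnion> z = x \<squnion> z"
proof -
  note [simp] = Drel_carrier[OF assms(1)] Drel_carrier[OF assms(2)]
  have "(y, z) \<in> Drel S" using assms Drel_sym Drel_trans by blast
  then have "(y, y \<squnion> z) \<in> Drel S" by (intro Drel_joinI) (auto simp: Drel_def)
  then have "(x, y \<squnion> z) \<in> Drel S" using assms(1) Drel_trans by blast
  then have 1: "x \<squnion> (y \<squnion> z) \<squnion> x = x" by (rule Drel_join_absorb)
  have "z \<squnion> x \<squnion> z = z" using assms Drel_sym Drel_join_absorb by blast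
  then have "x \<squnion> y \<squnion> z = x \<squnion> y \<squnion> (z \<squnion> x \<squnion> z)" by simp
  also have "\<dots> = x \<squnion> (y \<squnion> z) \<squnion> x \<squnion> z" by (simp add: join_assoc)
  finally show ?thesis using 1 by simp
qed

lemma Drel_meet_rect:
  assumes "(x, y) \<in> Drel S" "(x, z) \<in> Drel S"
  shows "x \<sqinter> y \<sqinter> z = x \<sqinter> z"
  using skew_lattice.Drel_join_rect[OF flip_skew_lattice] assms by (simp add: Drel_flip)

text \<open>The element \<open>y \<squnion> x\<close> is fixed by meeting with \<open>x\<close> on
  the left and with \<open>y\<close> on the right. It thus stands in the middle of a meet from
  \<open>x\<close> to \<open>y\<close> inside one \<D>-class, where the rectangular law deletes
  it.\<close>

lemma Drel_meet_eq_join: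
  assumes "(x, y) \<in> Drel S"
  shows "x \<sqinter> y = y \<squnion> x"
proof -
  note [simp] = Drel_carrier[OF assms]
  have "x \<squnion> y \<squnion> x = x" "y \<squnion> x \<squnion> y = y" using assms Drel_sym Drel_join_absorb by blast+
  then have "x \<sqinter> (y \<squnion> x) = y \<squnion> x" "(y \<squnion> x) \<sqinter> y = y \<squnion> x"
    using join_absorb_meet by simp_all
  then have "y \<squnion> x = x \<sqinter> (y \<squnion> x) \<sqinter> y" by simp
  also have "\<dots> = x \<sqinter> y"
    using assms Drel_joinI(2)[of x y] by (intro Drel_meet_rect) (auto simp: Drel_def)
  finally show ?thesis by simp
qed

lemma nat_ge_Drel_eq:
  assumes "(x, y) \<in> Drel S" "nat_ge S x y"
  shows "x = y"
  using Drel_join_absorb[OF Drel_sym[OF assms(1)]] assms(2) by (simp add: nat_ge_def)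

text \<open>A replacement for regularity of the band: \<open>y\<close> is \<open>\<D>\<close>-related to \<open>x \<sqinter> y \<sqinter> x \<le> x\<close>,
  and within a \<open>\<D>\<close>-class the rectangular law applies.\<close>

lemma join_class_cancel_left:
  assumes [simp]: "x \<in> carrier S" and "nat_preorder S x y" and yz: "(y, z) \<in> Drel S"
  shows "y \<squnion> z \<squnion> x = y \<squnion> x"
proof -
  note [simp] = Drel_carrier[OF yz]
  define w where "w = x \<sqinter> y \<sqinter> x"
  have [simp]: "w \<in> carrier S" by (simp add: w_def)
  have wx: "w \<squnion> x = x" unfolding w_def by simp
  have "(y, w) \<in> Drel S"
  proof -
    have "nat_preorder S x (x \<sqinter> y)" by (metis assms(1) \<open>y \<in> carrier S\<close> nat_preorder_meetI meet_idem)
    then have "(x \<sqinter> y, w) \<in> Drel S" unfolding w_def by (intro Drel_meetI) simp_all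
    then show ?thesis using Drel_meetI(1)[of x y] assms Drel_trans by auto
  qed
  then have "y \<squnion> z \<squnion> w = y \<squnion> w" using yz by (intro Drel_join_rect)
  then have "y \<squnion> z \<squnion> (w \<squnion> x) = y \<squnion> (w \<squnion> x)" by (simp add: join_assoc[symmetric])
  then show ?thesis by (simp add: wx)
qed

lemma join_class_cancel_right:
  assumes "x \<in> carrier S" "nat_preorder S x y" "(y, z) \<in> Drel S"
  shows "x \<squnion> z \<squnion> y = x \<squnion> y"
  using skew_lattice.join_class_cancel_left[OF dual_skew_lattice, of x y z] assms
    Drel_carrier[OF assms(3)]
  by (simp add: Drel_dual nat_preorder_dual join_assoc)

text \<open>Sandwiching a coset element between copies of \<open>z\<close> gives
  \<open>z \<squnion> a \<squnion> z\<close> whatever the outer factors are, since \<open>z\<close>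
  absorbs them. An element above \<open>z\<close> is its own sandwich, so a coset has at most one
  such element.\<close>

lemma upper_coset_eq:
  assumes [simp]: "a \<in> carrier S" and "nat_preorder S a z"
    and D: "(z, b1) \<in> Drel S" "(z, b2) \<in> Drel S" "(z, b3) \<in> Drel S" "(z, b4) \<in> Drel S"
    and y: "nat_ge S (b3 \<squnion> a \<squnion> b4) z"
  shows "b3 \<squnion> a \<squnion> b4 = z \<squnion> (b1 \<squnion> a \<squnion> b2) \<squnion> z"
proof -
  note [simp] = Drel_carrier[OF D(1)] Drel_carrier[OF D(2)] Drel_carrier[OF D(3)]
    Drel_carrier[OF D(4)]
  have *: "z \<squnion> (b \<squnion> a \<squnion> b') \<squnion> z = z \<squnion> a \<squnion> z"
    if "(z, b) \<in> Drel S" "(z, b') \<in> Drel S" for b b'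
  proof -
    note [simp] = Drel_carrier[OF that(1)] Drel_carrier[OF that(2)]
    have "z \<squnion> (b \<squnion> a \<squnion> b') \<squnion> z = (z \<squnion> b \<squnion> a) \<squnion> b' \<squnion> z"
      by (simp add: join_assoc)
    also have "\<dots> = z \<squnion> (a \<squnion> b' \<squnion> z)"
      using join_class_cancel_left[of a z b] assms that by (simp add: join_assoc)
    also have "\<dots> = z \<squnion> a \<squnion> z"
      using join_class_cancel_right[of a z b'] assms that by (simp add: join_assoc)
    finally show ?thesis .
  qed
  have "b3 \<squnion> a \<squnion> b4 = z \<squnion> (b3 \<squnion> a \<squnion> b4) \<squnion> z"
    using y by (simp add: nat_ge_def)
  then show ?thesis using *[of b3 b4] *[of b1 b2] D by simp
qed

lemma nat_ge_flip:
  assumes "x \<in> carrier S" "y \<in> carrier S"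
  shows "nat_ge (flip_alg S) x y \<longleftrightarrow> nat_ge S y x"
  using assms by (auto simp: nat_ge_def join_eq_left_iff join_eq_right_iff)

lemma nat_ge_dual: "nat_ge (dual_alg S) x y \<longleftrightarrow> nat_ge S x y"
  by (auto simp: nat_ge_def)

lemma lower_coset_eq:
  assumes "b \<in> carrier S" "nat_preorder S z b"
    and D: "(z, a1) \<in> Drel S" "(z, a2) \<in> Drel S" "(z, a3) \<in> Drel S" "(z, a4) \<in> Drel S"
    and "nat_ge S z (a3 \<sqinter> b \<sqinter> a4)"
  shows "a3 \<sqinter> b \<sqinter> a4 = z \<sqinter> (a1 \<sqinter> b \<sqinter> a2) \<sqinter> z"
  using skew_lattice.upper_coset_eq[OF flip_skew_lattice, of b z a1 a2 a3 a4] assms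
    Drel_carrier[OF D(1)] Drel_carrier[OF D(2)] Drel_carrier[OF D(3)] Drel_carrier[OF D(4)]
  by (simp add: Drel_flip nat_preorder_flip nat_ge_flip)

end

section \<open>Cosets and bad chains\<close>

context skew_lattice
begin

section \<open>\<D>-classes as sets and their order\<close>

lemma Dclass_carrier: "A \<in> Dclasses S \<Longrightarrow> x \<in> A \<Longrightarrow> x \<in> carrier S"
  using in_quotient_imp_subset[OF equiv_Drel] by (auto simp: Dclasses_def)

lemma Dclass_mem_iff: "A \<in> Dclasses S \<Longrightarrow> x \<in> A \<Longrightarrow> y \<in> A \<longleftrightarrow> (x, y) \<in> Drel S"
  using quotient_eq_iff[OF equiv_Drel, of A A x y] in_quotient_imp_closed[OF equiv_Drel, of A x y]
  unfolding Dclasses_def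
  by (metis equiv_Drel in_quotient_imp_in_rel empty_subsetI insert_subset)

lemma Dclass_Image: "A \<in> Dclasses S \<Longrightarrow> x \<in> A \<Longrightarrow> Drel S `` {x} = A"
  using Dclass_mem_iff by blast

lemma Dclass_of:
  assumes "x \<in> carrier S"
  shows "Drel S `` {x} \<in> Dclasses S" "x \<in> Drel S `` {x}"
  using assms by (auto simp: Dclasses_def quotientI Drel_refl)

lemma Dclass_join_closed:
  "A \<in> Dclasses S \<Longrightarrow> x \<in> A \<Longrightarrow> y \<in> carrier S \<Longrightarrow> nat_preorder S x y \<Longrightarrow> x \<squnion> y \<in> A"
  "A \<in> Dclasses S \<Longrightarrow> x \<in> A \<Longrightarrow> y \<in> carrier S \<Longrightarrow> nat_preorder S x y \<Longrightarrow> y \<squnion> x \<in> A"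
  using Drel_joinI[of x y] Dclass_carrier[of A x] Dclass_mem_iff[of A x] by blast+

lemma Dclass_meet_closed:
  "A \<in> Dclasses S \<Longrightarrow> y \<in> A \<Longrightarrow> x \<in> carrier S \<Longrightarrow> nat_preorder S x y \<Longrightarrow> x \<sqinter> y \<in> A"
  "A \<in> Dclasses S \<Longrightarrow> y \<in> A \<Longrightarrow> x \<in> carrier S \<Longrightarrow> nat_preorder S x y \<Longrightarrow> y \<sqinter> x \<in> A"
  using Drel_meetI[of x y] Dclass_carrier[of A y] Dclass_mem_iff[of A y] by blast+

lemma Dclass_preorder: "A \<in> Dclasses S \<Longrightarrow> x \<in> A \<Longrightarrow> y \<in> A \<Longrightarrow> nat_preorder S x y"
  using Dclass_mem_iff by (auto simp: Drel_def)

text \<open>Reduces the order of the quotient lattice to arbitrarily chosen representatives;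
  \<open>b\<close> is \<D>-related to \<open>a \<sqinter> b\<close> exactly if it lies below
  \<open>a\<close> in the preorder.\<close>

lemma Dgt_iff:
  assumes A: "A \<in> Dclasses S" and B: "B \<in> Dclasses S" and a: "a \<in> A" and b: "b \<in> B"
  shows "Dgt S A B \<longleftrightarrow> nat_preorder S a b \<and> (a, b) \<notin> Drel S"
proof
  have [simp]: "a \<in> carrier S" "b \<in> carrier S" using assms Dclass_carrier by auto
  {
    assume AB: "Dgt S A B"
    have "(a \<sqinter> b, a \<sqinter> b) \<in> Drel S" by (simp add: Drel_refl)
    then have "a \<sqinter> b \<in> Dmeet S A B" using a b by (auto simp: Dmeet_def)
    then have "(b, a \<sqinter> b) \<in> Drel S" using AB B b Dclass_mem_iff by (auto simp: Dgt_def)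
    then have "b \<sqinter> a \<sqinter> b = b"
      using Drel_meet_absorb[of b "a \<sqinter> b"] by (simp add: meet_assoc)
    moreover have "(a, b) \<notin> Drel S"
      using AB a b Dclass_Image[OF A] Dclass_Image[OF B] Dclass_mem_iff[OF A a]
      by (metis Dgt_def)
    ultimately show "nat_preorder S a b \<and> (a, b) \<notin> Drel S" by (simp add: nat_preorder_iff_meet)
  next
    assume ab: "nat_preorder S a b \<and> (a, b) \<notin> Drel S"
    have "Drel S `` {x \<sqinter> y} = B" if "x \<in> A" "y \<in> B" for x y
    proof -
      have "x \<in> carrier S" "y \<in> carrier S" using that A B Dclass_carrier by auto
      moreover have "nat_preorder S x a" "nat_preorder S b y"
        using that assms Dclass_preorder by auto
      ultimately have "nat_preorder S x y"
        using ab nat_preorder_trans by (meson \<open>a \<in> carrier S\<close> \<open>b \<in> carrier S\<close>)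
      then show ?thesis
        using Dclass_Image[OF B] Dclass_meet_closed[OF B] that \<open>x \<in> carrier S\<close> by auto
    qed
    then have "Dmeet S A B = B" using a b by (auto simp: Dmeet_def)
    then show "Dgt S A B" using ab a b Dclass_mem_iff[OF A] by (auto simp: Dgt_def)
  }
qed

text \<open>An explicit formula for the inverse of a coset bijection: the partner of
  \<open>z\<close> in a coset is the sandwich of any coset member between copies of
  \<open>z\<close>.\<close>

lemma upper_coset_mem_eq:
  assumes A: "A \<in> Dclasses S" and B: "B \<in> Dclasses S" and "Dgt S A B"
    and X: "X \<in> upper_cosets S A B" and "x \<in> X" "y \<in> X" "z \<in> B" "nat_ge S y z"
  shows "y = z \<squnion> x \<squnion> z"
proof -
  obtain a where a: "a \<in> A" "X = {b \<squnion> a \<squnion> b' | b b'. b \<in> B \<and> b' \<in> B}"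
    using X by (auto simp: upper_cosets_def)
  with assms obtain b1 b2 b3 b4 where b: "x = b1 \<squnion> a \<squnion> b2" "y = b3 \<squnion> a \<squnion> b4"
    "b1 \<in> B" "b2 \<in> B" "b3 \<in> B" "b4 \<in> B" by blast
  show ?thesis unfolding b(1,2)
    using assms a b Dgt_iff[OF A B, of a z] Dclass_mem_iff[OF B] Dclass_carrier[OF A]
    by (intro upper_coset_eq) auto
qed

lemma lower_coset_mem_eq:
  assumes A: "A \<in> Dclasses S" and B: "B \<in> Dclasses S" and "Dgt S A B"
    and X: "X \<in> lower_cosets S A B" and "x \<in> X" "y \<in> X" "z \<in> A" "nat_ge S z y"
  shows "y = z \<sqinter> x \<sqinter> z"
proof -
  obtain b where a: "b \<in> B" "X = {a \<sqinter> b \<sqinter> a' | a a'. a \<in> A \<and> a' \<in> A}"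
    using X by (auto simp: lower_cosets_def)
  with assms obtain b1 b2 b3 b4 where b: "x = b1 \<sqinter> b \<sqinter> b2" "y = b3 \<sqinter> b \<sqinter> b4"
    "b1 \<in> A" "b2 \<in> A" "b3 \<in> A" "b4 \<in> A" by blast
  show ?thesis unfolding b(1,2)
    using assms a b Dgt_iff[OF A B, of z b] Dclass_mem_iff[OF A] Dclass_carrier[OF B]
    by (intro lower_coset_eq) auto
qed

lemma upper_coset_closed:
  assumes B: "B \<in> Dclasses S" and A: "A \<in> Dclasses S"
    and X: "X \<in> upper_cosets S A B" "x \<in> X" and b: "b \<in> B" "b' \<in> B"
  shows "b \<squnion> x \<squnion> b' \<in> X"
proof -
  obtain a where a: "a \<in> A" "X = {b \<squnion> a \<squnion> b' | b b'. b \<in> B \<and> b' \<in> B}"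
    using X by (auto simp: upper_cosets_def)
  then obtain b1 b2 where x: "x = b1 \<squnion> a \<squnion> b2" "b1 \<in> B" "b2 \<in> B" using X by blast
  have "b \<squnion> x \<squnion> b' = (b \<squnion> b1) \<squnion> a \<squnion> (b2 \<squnion> b')"
    using Dclass_carrier[OF B] Dclass_carrier[OF A] a(1) b x by (simp add: join_assoc)
  moreover have "b \<squnion> b1 \<in> B" "b2 \<squnion> b' \<in> B"
    using b x Dclass_join_closed[OF B] Dclass_carrier[OF B] Dclass_preorder[OF B] by auto
  ultimately show ?thesis using a(2) by blast
qed

lemma lower_coset_closed:
  assumes B: "B \<in> Dclasses S" and A: "A \<in> Dclasses S"
    and X: "X \<in> lower_cosets S A B" "x \<in> X" and b: "b \<in> A" "b' \<in> A"
  shows "b \<sqinter> x \<sqinter> b' \<in> X"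
proof -
  obtain a where a: "a \<in> B" "X = {b \<sqinter> a \<sqinter> b' | b b'. b \<in> A \<and> b' \<in> A}"
    using X by (auto simp: lower_cosets_def)
  then obtain b1 b2 where x: "x = b1 \<sqinter> a \<sqinter> b2" "b1 \<in> A" "b2 \<in> A" using X by blast
  have "b \<sqinter> x \<sqinter> b' = (b \<sqinter> b1) \<sqinter> a \<sqinter> (b2 \<sqinter> b')"
    using Dclass_carrier[OF B] Dclass_carrier[OF A] a(1) b x by (simp add: meet_assoc)
  moreover have "b \<sqinter> b1 \<in> A" "b2 \<sqinter> b' \<in> A"
    using b x Dclass_meet_closed[OF A] Dclass_carrier[OF A] Dclass_preorder[OF A] by auto
  ultimately show ?thesis using a(2) by blast
qed

lemma cosets_subset:
  assumes A: "A \<in> Dclasses S" and B: "B \<in> Dclasses S" and AB: "Dgt S A B"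
  shows "X \<in> upper_cosets S A B \<Longrightarrow> X \<subseteq> A" "Y \<in> lower_cosets S A B \<Longrightarrow> Y \<subseteq> B"
proof -
  have ge: "nat_preorder S a b" if "a \<in> A" "b \<in> B" for a b
    using Dgt_iff[OF A B that] AB by simp
  note cl = Dclass_join_closed[OF A] Dclass_meet_closed[OF B] ge Dclass_carrier[OF A]
    Dclass_carrier[OF B]
  show "X \<in> upper_cosets S A B \<Longrightarrow> X \<subseteq> A"
    unfolding upper_cosets_def by clarsimp (intro cl; assumption)
  show "Y \<in> lower_cosets S A B \<Longrightarrow> Y \<subseteq> B"
    unfolding lower_cosets_def by clarsimp (intro cl; assumption)
qed

lemma coset_of:
  assumes A: "A \<in> Dclasses S" and B: "B \<in> Dclasses S" and a: "a \<in> A" and b: "b \<in> B"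
    and ab: "nat_ge S a b"
  shows "\<exists>X\<in>upper_cosets S A B. a \<in> X" "\<exists>Y\<in>lower_cosets S A B. b \<in> Y"
proof -
  have "a \<in> carrier S" "b \<in> carrier S" using assms Dclass_carrier by auto
  then have "a = b \<squnion> a \<squnion> b" "b = a \<sqinter> b \<sqinter> a"
    using ab nat_ge_iff_meet[of a b] by (simp_all add: nat_ge_def)
  then have "a \<in> {b \<squnion> a \<squnion> b' | b b'. b \<in> B \<and> b' \<in> B}"
    "b \<in> {a \<sqinter> b \<sqinter> a' | a a'. a \<in> A \<and> a' \<in> A}"
    using a b by blast+
  then show "\<exists>X\<in>upper_cosets S A B. a \<in> X" "\<exists>Y\<in>lower_cosets S A B. b \<in> Y"
    using a b unfolding upper_cosets_def lower_cosets_def by (meson imageI)+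
qed

section \<open>Categoricity as the absence of bad chains\<close>

lemma nat_geI_meet:
  assumes "x \<in> carrier S" "y \<in> carrier S" "x \<sqinter> y \<sqinter> x = z"
  shows "nat_ge S x z"
  using assms by (auto simp: nat_ge_iff_meet meet_assoc meet_left_idem)

lemma nat_geI_join:
  assumes "x \<in> carrier S" "y \<in> carrier S" "y \<squnion> x \<squnion> y = z"
  shows "nat_ge S z y"
  using assms by (auto simp: nat_ge_def join_assoc join_left_idem)

lemma nat_ge_trans:
  assumes "x \<in> carrier S" "y \<in> carrier S" "z \<in> carrier S" "nat_ge S x y" "nat_ge S y z"
  shows "nat_ge S x z"
  using assms unfolding nat_ge_def by (metis join_assoc)

lemma coset_bijectionsE:
  assumes "\<phi> \<in> coset_bijections S A B"
  obtains X Y where "X \<in> upper_cosets S A B" "Y \<in> lower_cosets S A B"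
    "\<phi> = {(a, b) \<in> X \<times> Y. nat_gt S a b}"
  using assms unfolding coset_bijections_def by blast

text \<open>A nonempty composite is always contained in the coset bijection through one of its pairs
  \<open>(a, c)\<close>. If it is not a coset bijection, the inclusion is strict, and a missing pair
  \<open>(a', c')\<close> completes a bad chain.\<close>

lemma bad_chain_if_not_categorical:
  assumes "\<not> categorical S"
  shows "\<exists>a b c a' c'. bad_chain S a b c a' c'"
proof -
  obtain A B C \<phi> \<psi> where A: "A \<in> Dclasses S" and B: "B \<in> Dclasses S" and C: "C \<in> Dclasses S"
    and AB: "Dgt S A B" and BC: "Dgt S B C"
    and \<phi>0: "\<phi> \<in> coset_bijections S A B" and \<psi>0: "\<psi> \<in> coset_bijections S B C"
    and ne: "\<phi> O \<psi> \<noteq> {}" and non: "\<phi> O \<psi> \<notin> coset_bijections S A C"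
    using assms unfolding categorical_def categorical_chain_def by blast
  obtain X Y where X: "X \<in> upper_cosets S A B" and Y: "Y \<in> lower_cosets S A B"
    and \<phi>: "\<phi> = {(a, b) \<in> X \<times> Y. nat_gt S a b}"
    using \<phi>0 by (rule coset_bijectionsE)
  obtain X2 Y2 where X2: "X2 \<in> upper_cosets S B C" and Y2: "Y2 \<in> lower_cosets S B C"
    and \<psi>: "\<psi> = {(a, b) \<in> X2 \<times> Y2. nat_gt S a b}"
    using \<psi>0 by (rule coset_bijectionsE)
  obtain a b c where abc: "a \<in> X" "b \<in> Y" "b \<in> X2" "c \<in> Y2" "nat_ge S a b" "nat_ge S b c"
    using ne unfolding \<phi> \<psi> nat_gt_def by blast
  have sub: "X \<subseteq> A" "Y \<subseteq> B" "Y2 \<subseteq> C"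
    using cosets_subset(1)[OF A B AB X] cosets_subset(2)[OF A B AB Y]
      cosets_subset(2)[OF B C BC Y2] by simp_all
  have mem: "a \<in> A" "b \<in> B" "c \<in> C" using abc sub by blast+
  note carr = Dclass_carrier[OF A] Dclass_carrier[OF B] Dclass_carrier[OF C]
  note [simp] = mem carr(1)[OF mem(1)] carr(2)[OF mem(2)] carr(3)[OF mem(3)]
  have ac: "nat_ge S a c"
    using abc(5,6) by (rule nat_ge_trans[rotated 3]) simp_all
  have [simp]: "(a, b) \<notin> Drel S" using Dgt_iff[OF A B mem(1,2)] AB by blast
  have AC: "Dgt S A C"
    using Dgt_iff[OF A B mem(1,2)] Dgt_iff[OF B C mem(2,3)] Dgt_iff[OF A C mem(1,3)] AB BC
      nat_preorder_trans[of a b c] nat_preorder_trans[of b c a] by (auto simp: Drel_def)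
  obtain X3 Y3 where X3: "X3 \<in> upper_cosets S A C" "a \<in> X3"
    and Y3: "Y3 \<in> lower_cosets S A C" "c \<in> Y3"
    using coset_of[OF A C mem(1,3) ac] by blast
  have sub3: "X3 \<subseteq> A" "Y3 \<subseteq> C"
    using cosets_subset(1)[OF A C AC X3(1)] cosets_subset(2)[OF A C AC Y3(1)] by simp_all
  \<comment> \<open>The coset bijection through \<open>(a, c)\<close>, the candidate that the
    composite fails to equal.\<close>
  define \<chi> where "\<chi> = {(a, b) \<in> X3 \<times> Y3. nat_gt S a b}"
  have "\<chi> \<in> coset_bijections S A C" using X3 Y3 unfolding coset_bijections_def \<chi>_def by blast
  then have neq: "\<phi> O \<psi> \<noteq> \<chi>" using non by blast
  have ge: "nat_preorder S x y" if "x \<in> B" "y \<in> C" for x y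
    using Dgt_iff[OF B C that] BC by simp
  have ge': "nat_preorder S x y" if "x \<in> A" "y \<in> B" for x y
    using Dgt_iff[OF A B that] AB by simp
  have ne: "x \<noteq> y" if "x \<in> A" "y \<in> B" for x y
    using Dgt_iff[OF A B that] AB that Drel_refl carr by blast
  have ne2: "x \<noteq> y" if "x \<in> B" "y \<in> C" for x y
    using Dgt_iff[OF B C that] BC that Drel_refl carr by blast
  have ne3: "x \<noteq> y" if "x \<in> A" "y \<in> C" for x y
    using Dgt_iff[OF A C that] AC that Drel_refl carr by blast
  \<comment> \<open>The middle element \<open>b'\<close> has one formula from each side. Inserting
    the join formula into \<open>a' = b' \<squnion> a \<squnion> b'\<close> and the meet formula
    into \<open>c' = b' \<sqinter> c \<sqinter> b'\<close> eliminates \<open>b\<close>, and leaves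
    members of the cosets of \<open>a\<close> and \<open>c\<close>.\<close>
  have "\<phi> O \<psi> \<subseteq> \<chi>"
  proof (rule subrelI)
    fix a' c' assume "(a', c') \<in> \<phi> O \<psi>"
    then obtain b' where *: "a' \<in> X" "b' \<in> Y" "b' \<in> X2" "c' \<in> Y2" "nat_ge S a' b'" "nat_ge S b' c'"
      unfolding \<phi> \<psi> nat_gt_def by blast
    have mem': "a' \<in> A" "b' \<in> B" "c' \<in> C" using * sub by blast+
    note [simp] = carr(1)[OF mem'(1)] carr(2)[OF mem'(2)] carr(3)[OF mem'(3)]
    have b': "b' = c' \<squnion> b \<squnion> c'"
      by (rule upper_coset_mem_eq[OF B C BC X2 abc(3) *(3) mem'(3) *(6)])
    have a': "a' = b' \<squnion> a \<squnion> b'"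
      by (rule upper_coset_mem_eq[OF A B AB X abc(1) *(1) mem'(2) *(5)])
    have b'2: "b' = a' \<sqinter> b \<sqinter> a'"
      by (rule lower_coset_mem_eq[OF A B AB Y abc(2) *(2) mem'(1) *(5)])
    have c': "c' = b' \<sqinter> c \<sqinter> b'"
      by (rule lower_coset_mem_eq[OF B C BC Y2 abc(4) *(4) mem'(2) *(6)])
    have 1: "b \<squnion> (c' \<squnion> b) = b"
      using ge[OF mem(2) mem'(3)] by (simp add: nat_preorder_def join_assoc)
    have 2: "b \<sqinter> (a' \<sqinter> b) = b"
      using ge'[OF mem'(1) mem(2)] by (simp add: nat_preorder_iff_meet meet_assoc)
    have ab: "b \<squnion> a = a" "a \<squnion> b = a" "b \<sqinter> c = c" "c \<sqinter> b = c"
      using abc(5,6) nat_ge_iff_meet[of b c] by (auto simp: nat_ge_def)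
    have "b' \<squnion> a \<squnion> b' = c' \<squnion> b \<squnion> c' \<squnion> (b \<squnion> a \<squnion> b) \<squnion> (c' \<squnion> b \<squnion> c')"
      by (simp add: b' ab)
    also have "\<dots> = c' \<squnion> (b \<squnion> (c' \<squnion> b)) \<squnion> a \<squnion> (b \<squnion> (c' \<squnion> b)) \<squnion> c'"
      by (simp add: join_assoc)
    also have "\<dots> = c' \<squnion> a \<squnion> c'" by (simp only: 1) (simp add: ab join_assoc)
    finally have "a' \<in> X3"
      using a' upper_coset_closed[OF C A X3 mem'(3,3)] by simp
    have "b' \<sqinter> c \<sqinter> b' = a' \<sqinter> b \<sqinter> a' \<sqinter> (b \<sqinter> c \<sqinter> b) \<sqinter> (a' \<sqinter> b \<sqinter> a')"
      by (subst (1 2) b'2) (simp add: ab)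
    also have "\<dots> = a' \<sqinter> (b \<sqinter> (a' \<sqinter> b)) \<sqinter> c \<sqinter> (b \<sqinter> (a' \<sqinter> b)) \<sqinter> a'"
      by (simp add: meet_assoc)
    also have "\<dots> = a' \<sqinter> c \<sqinter> a'" by (simp only: 2) (simp add: ab meet_assoc)
    finally have "c' \<in> Y3"
      using c' lower_coset_closed[OF C A Y3 mem'(1,1)] by simp
    moreover have "nat_ge S a' c'"
      using *(5,6) by (rule nat_ge_trans[rotated 3]) simp_all
    ultimately show "(a', c') \<in> \<chi>"
      using \<open>a' \<in> X3\<close> ne3[OF mem'(1,3)] by (simp add: \<chi>_def nat_gt_def)
  qed
  then obtain a' c' where ac': "(a', c') \<in> \<chi>" "(a', c') \<notin> \<phi> O \<psi>" using neq by (meson subrelI subset_antisym)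
  then have *: "a' \<in> X3" "c' \<in> Y3" "nat_ge S a' c'" by (auto simp: \<chi>_def nat_gt_def)
  have mem': "a' \<in> A" "c' \<in> C" using * sub3 by blast+
  note [simp] = carr(1)[OF mem'(1)] carr(3)[OF mem'(2)]
  have a': "a' = c' \<squnion> a \<squnion> c'"
    by (rule upper_coset_mem_eq[OF A C AC X3(1) X3(2) *(1) mem'(2) *(3)])
  have c': "c' = a' \<sqinter> c \<sqinter> a'"
    by (rule lower_coset_mem_eq[OF A C AC Y3(1) Y3(2) *(2) mem'(1) *(3)])
  define b' where "b' = a' \<sqinter> b \<sqinter> a'"
  have "b' \<noteq> c' \<squnion> b \<squnion> c'"
  proof
    assume b': "b' = c' \<squnion> b \<squnion> c'"
    have "b' \<in> Y" unfolding b'_def by (rule lower_coset_closed[OF B A Y abc(2) mem'(1,1)])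
    moreover have "b' \<in> X2" unfolding b' by (rule upper_coset_closed[OF C B X2 abc(3) mem'(2,2)])
    moreover have "nat_ge S a' b'"
      by (rule nat_geI_meet[where y = b]) (simp_all add: b'_def)
    moreover have "nat_ge S b' c'"
      by (rule nat_geI_join[where x = b]) (simp_all add: b')
    \<comment> \<open>As \<open>a\<close> absorbs \<open>b\<close>, the factor \<open>a\<close> in
      \<open>c' \<squnion> a \<squnion> c'\<close> can be padded with \<open>b\<close>. This turns
      the outer factors into elements of \<open>B\<close>, so the \<open>C\<close>-sandwich is also
      a \<open>B\<close>-sandwich.\<close>
    moreover have "a' \<in> X"
    proof -
      have "a' = c' \<squnion> (b \<squnion> a \<squnion> b) \<squnion> c'" using a' abc(5) by (simp add: nat_ge_def)
      then have "a' = (c' \<squnion> b) \<squnion> a \<squnion> (b \<squnion> c')" by (simp add: join_assoc)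
      moreover have "c' \<squnion> b \<in> B" "b \<squnion> c' \<in> B"
        using Dclass_join_closed[OF B mem(2) _ ge[OF mem(2) mem'(2)]] by simp_all
      ultimately show ?thesis
        using upper_coset_closed[OF B A X abc(1), of "c' \<squnion> b" "b \<squnion> c'"] by simp
    qed
    moreover have "c' \<in> Y2"
    proof -
      have "c' = a' \<sqinter> (b \<sqinter> c \<sqinter> b) \<sqinter> a'" using c' abc(6) nat_ge_iff_meet[of b c] by simp
      then have "c' = (a' \<sqinter> b) \<sqinter> c \<sqinter> (b \<sqinter> a')" by (simp add: meet_assoc)
      moreover have "a' \<sqinter> b \<in> B" "b \<sqinter> a' \<in> B"
        using Dclass_meet_closed[OF B mem(2) _ ge'[OF mem'(1) mem(2)]] by simp_all
      ultimately show ?thesis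
        using lower_coset_closed[OF C B Y2 abc(4), of "a' \<sqinter> b" "b \<sqinter> a'"] by simp
    qed
    moreover have "b' \<in> B" using \<open>b' \<in> Y\<close> sub by blast
    ultimately have "(a', b') \<in> \<phi>" "(b', c') \<in> \<psi>"
      unfolding \<phi> \<psi> nat_gt_def using ne[OF mem'(1)] ne2[OF _ mem'(2)] \<open>c' \<in> Y2\<close> by auto
    then show False using ac' by blast
  qed
  then have "bad_chain S a b c a' c'"
    using a'[symmetric] c'[symmetric] abc(5,6) unfolding bad_chain_def b'_def by simp
  then show ?thesis by blast
qed

text \<open>Recovers from the two sandwich equations that \<open>a'\<close> and \<open>c'\<close>
  lie in the classes of \<open>a\<close> and \<open>c\<close>. One comparison is that of a sandwich
  with its filling; the other holds because \<open>a'\<close> lies above \<open>c\<close> and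
  \<open>a\<close> above \<open>c'\<close>.\<close>

lemma bad_chain_Drel:
  assumes "bad_chain S a b c a' c'"
  shows "(a, a') \<in> Drel S" "(c, c') \<in> Drel S"
proof -
  have [simp]: "a \<in> carrier S" "b \<in> carrier S" "c \<in> carrier S" "a' \<in> carrier S" "c' \<in> carrier S"
    and ab: "nat_ge S a b" and bc: "nat_ge S b c"
    and a': "c' \<squnion> a \<squnion> c' = a'" and c': "a' \<sqinter> c \<sqinter> a' = c'"
    using assms by (auto simp: bad_chain_def)
  have pac: "nat_preorder S a c"
    using ab bc by (intro nat_ge_imp_preorder nat_ge_trans[of a b c]) simp_all
  have p1: "nat_preorder S c c'" using nat_preorder_meetI[of a' a' c] c' by simp
  have p2: "nat_preorder S a' a" using nat_preorder_joinI[of c' c' a] a' by simp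
  show "(c, c') \<in> Drel S"
  proof -
    have "nat_preorder S a' c" using p2 pac nat_preorder_trans by (meson \<open>a \<in> carrier S\<close> \<open>a' \<in> carrier S\<close> \<open>c \<in> carrier S\<close>)
    then have "c \<sqinter> a' \<sqinter> c = c" by (simp add: nat_preorder_iff_meet)
    then have "c \<sqinter> c' \<sqinter> c = c" unfolding c'[symmetric] by (metis meet_assoc meet_closed meet_idem \<open>a' \<in> carrier S\<close> \<open>c \<in> carrier S\<close>)
    then show ?thesis using p1 by (simp add: Drel_def nat_preorder_iff_meet)
  qed
  show "(a, a') \<in> Drel S"
  proof -
    have "nat_preorder S a c'" using p1 pac nat_preorder_trans by (meson \<open>a \<in> carrier S\<close> \<open>c' \<in> carrier S\<close> \<open>c \<in> carrier S\<close>)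
    then have "a \<squnion> c' \<squnion> a = a" by (simp add: nat_preorder_def)
    then have "a \<squnion> a' \<squnion> a = a" unfolding a'[symmetric] by (metis join_assoc join_closed join_idem \<open>a \<in> carrier S\<close> \<open>c' \<in> carrier S\<close>)
    then show ?thesis using p2 by (simp add: Drel_def nat_preorder_def)
  qed
qed

text \<open>A coset bijection containing \<open>(a, c)\<close> also contains
  \<open>(a', c')\<close>. In the composite, the element linking this pair would have to equal both
  sides of the inequation.\<close>

lemma not_categorical_if_bad_chain:
  assumes "bad_chain S a b c a' c'"
  shows "\<not> categorical S"
proof
  assume cat: "categorical S"
  have [simp]: "a \<in> carrier S" "b \<in> carrier S" "c \<in> carrier S" "a' \<in> carrier S" "c' \<in> carrier S"
    and ab: "nat_ge S a b" and bc: "nat_ge S b c"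
    and a': "c' \<squnion> a \<squnion> c' = a'" and c': "a' \<sqinter> c \<sqinter> a' = c'"
    and neq: "a' \<sqinter> b \<sqinter> a' \<noteq> c' \<squnion> b \<squnion> c'"
    using assms by (auto simp: bad_chain_def)
  have pab: "nat_preorder S a b" and pbc: "nat_preorder S b c"
    using ab bc nat_ge_imp_preorder by auto
  note Da = bad_chain_Drel(1)[OF assms] and Dc = bad_chain_Drel(2)[OF assms]
  \<comment> \<open>The inequation forces a strict chain: if \<open>a = b\<close>, both of its sides
    reduce to \<open>a'\<close>; likewise \<open>b = c\<close> reduces both to
    \<open>c'\<close>.\<close>
  have nab: "(a, b) \<notin> Drel S"
    using nat_ge_Drel_eq[OF _ ab] neq a' Drel_meet_absorb[OF Drel_sym[OF Da]] by auto
  have nbc: "(b, c) \<notin> Drel S"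
    using nat_ge_Drel_eq[OF _ bc] neq c' Drel_join_absorb[OF Drel_sym[OF Dc]] by auto
  define A B C where "A = Drel S `` {a}" and "B = Drel S `` {b}" and "C = Drel S `` {c}"
  have A: "A \<in> Dclasses S" "a \<in> A" and B: "B \<in> Dclasses S" "b \<in> B" and C: "C \<in> Dclasses S" "c \<in> C"
    using Dclass_of by (simp_all add: A_def B_def C_def)
  have mem': "a' \<in> A" "c' \<in> C" using Da Dc by (simp_all add: A_def C_def)
  have AB: "Dgt S A B" and BC: "Dgt S B C"
    using Dgt_iff[OF A(1) B(1) A(2) B(2)] Dgt_iff[OF B(1) C(1) B(2) C(2)] nab nbc pab pbc by auto
  have nac: "(x, y) \<notin> Drel S" if "x \<in> A" "y \<in> C" for x y
  proof
    assume "(x, y) \<in> Drel S"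
    then have "(a, c) \<in> Drel S" using that Drel_sym Drel_trans unfolding A_def C_def by blast
    then have "nat_preorder S c a" by (auto simp: Drel_def)
    then have "nat_preorder S b a" using pbc nat_preorder_trans[of b c a] by simp
    then show False using pab nab by (simp add: Drel_def)
  qed
  obtain X Y where X: "X \<in> upper_cosets S A B" "a \<in> X" and Y: "Y \<in> lower_cosets S A B" "b \<in> Y"
    using coset_of[OF A(1) B(1) A(2) B(2) ab] by blast
  obtain X2 Y2 where X2: "X2 \<in> upper_cosets S B C" "b \<in> X2" and Y2: "Y2 \<in> lower_cosets S B C" "c \<in> Y2"
    using coset_of[OF B(1) C(1) B(2) C(2) bc] by blast
  define \<phi> where "\<phi> = {(a, b) \<in> X \<times> Y. nat_gt S a b}"
  define \<psi> where "\<psi> = {(a, b) \<in> X2 \<times> Y2. nat_gt S a b}"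
  have "\<phi> \<in> coset_bijections S A B" "\<psi> \<in> coset_bijections S B C"
    using X Y X2 Y2 unfolding \<phi>_def \<psi>_def coset_bijections_def by blast+
  moreover have in_comp: "(a, c) \<in> \<phi> O \<psi>"
    using X Y X2 Y2 ab bc nab nbc Drel_refl
    unfolding \<phi>_def \<psi>_def nat_gt_def by (intro relcompI[of a b]) auto
  ultimately have "\<phi> O \<psi> \<in> coset_bijections S A C"
    using cat A B C AB BC unfolding categorical_def categorical_chain_def by blast
  then obtain X3 Y3 where X3: "X3 \<in> upper_cosets S A C" and Y3: "Y3 \<in> lower_cosets S A C"
    and eq: "\<phi> O \<psi> = {(a, b) \<in> X3 \<times> Y3. nat_gt S a b}"
    by (rule coset_bijectionsE)
  have "a \<in> X3" "c \<in> Y3" using in_comp eq by auto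
  then have "a' \<in> X3" "c' \<in> Y3"
    using upper_coset_closed[OF C(1) A(1) X3 _ mem'(2,2), of a]
      lower_coset_closed[OF C(1) A(1) Y3 _ mem'(1,1), of c] a' c' by simp_all
  moreover have "nat_gt S a' c'"
    using nat_geI_meet[OF _ _ c'] nac[OF mem'] Drel_refl[of a'] by (auto simp: nat_gt_def)
  ultimately have "(a', c') \<in> \<phi> O \<psi>" using eq by auto
  then obtain b' where b': "nat_ge S a' b'" "nat_ge S b' c'" "b' \<in> Y" "b' \<in> X2"
    unfolding \<phi>_def \<psi>_def nat_gt_def by blast
  have "b' = a' \<sqinter> b \<sqinter> a'"
    using lower_coset_mem_eq[OF A(1) B(1) AB Y(1)] Y b' mem' by blast
  moreover have "b' = c' \<squnion> b \<squnion> c'"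
    using upper_coset_mem_eq[OF B(1) C(1) BC X2(1)] X2 b' mem' by blast
  ultimately show False using neq by simp
qed

lemma categorical_iff: "categorical S \<longleftrightarrow> (\<nexists>a b c a' c'. bad_chain S a b c a' c')"
  using bad_chain_if_not_categorical not_categorical_if_bad_chain by blast

end

section \<open>One-sided bad chains and moves of the middle element\<close>

text \<open>The elements \<L>-related to \<open>b\<close> and lying between \<open>a\<close> and
  \<open>c\<close>, from which the sequence in the middle class is drawn.\<close>

definition left_mid :: "('a, 'm) skew_alg_scheme \<Rightarrow> 'a \<Rightarrow> 'a \<Rightarrow> 'a \<Rightarrow> 'a \<Rightarrow> bool" where
  "left_mid S b a c x \<longleftrightarrow> x \<in> carrier S \<and> x \<sqinter>\<^bsub>S\<^esub> b = x \<and> b \<sqinter>\<^bsub>S\<^esub> x = b \<and>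
    nat_ge S a x \<and> nat_ge S x c"

context skew_lattice
begin

lemma bad_chain_dual: "bad_chain S a b c a' c' \<Longrightarrow> bad_chain (dual_alg S) a b c a' c'"
  unfolding bad_chain_def nat_ge_dual by (elim conjE) (simp add: join_assoc meet_assoc)

text \<open>The new ends are the \<L>-components of \<open>a'\<close> and \<open>c'\<close> relative
  to \<open>a\<close> and \<open>c\<close>: \<open>a \<squnion> c' = a' \<sqinter> a\<close> and
  \<open>a' \<sqinter> c = c' \<sqinter> c\<close>. They act on \<open>b\<close> as
  \<open>a'\<close> and \<open>c'\<close> do, since \<open>a \<sqinter> b = b\<close> and
  \<open>b \<squnion> c = b\<close>.\<close>

lemma left_bad_chainI:
  assumes "bad_chain S a b c a' c'" and neq: "a' \<sqinter> b \<noteq> b \<squnion> c'"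
  shows "left_bad_chain S a b c (a \<squnion> c') (a' \<sqinter> c)"
proof -
  have [simp]: "a \<in> carrier S" "b \<in> carrier S" "c \<in> carrier S" "a' \<in> carrier S" "c' \<in> carrier S"
    and ab: "nat_ge S a b" and bc: "nat_ge S b c"
    and a': "c' \<squnion> a \<squnion> c' = a'" and c': "a' \<sqinter> c \<sqinter> a' = c'"
    using assms(1) by (auto simp: bad_chain_def)
  note Da = bad_chain_Drel(1)[OF assms(1)] and Dc = bad_chain_Drel(2)[OF assms(1)]
  have "nat_ge S a c" using ab bc by (rule nat_ge_trans[rotated 3]) simp_all
  then have 1: "a \<squnion> c = a" "a \<sqinter> c = c" "a \<sqinter> b = b" "b \<squnion> c = b"
    using ab bc nat_ge_iff_meet[of a c] nat_ge_iff_meet[of a b] by (auto simp: nat_ge_def)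
  have "a \<squnion> a' = a \<squnion> c'"
    unfolding a'[symmetric] by (metis \<open>a \<in> carrier S\<close> \<open>c' \<in> carrier S\<close> join_assoc join_closed join_idem)
  then have a2: "a \<squnion> c' = a' \<sqinter> a" using Drel_meet_eq_join[OF Drel_sym[OF Da]] by simp
  have "c' \<sqinter> c = a' \<sqinter> c"
    unfolding c'[symmetric] by (metis \<open>a' \<in> carrier S\<close> \<open>c \<in> carrier S\<close> meet_assoc meet_closed meet_idem)
  then have c2: "a' \<sqinter> c = c' \<sqinter> c" "a' \<sqinter> c = c \<squnion> c'"
    using Drel_meet_eq_join[OF Drel_sym[OF Dc]] by simp_all
  have "a \<sqinter> (a \<squnion> c') = a" by simp
  moreover have "(a \<squnion> c') \<sqinter> a = a \<squnion> c'" unfolding a2 by (simp add: meet_assoc)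
  moreover have "c \<sqinter> (a' \<sqinter> c) = c" unfolding c2(2) by simp
  moreover have "(a' \<sqinter> c) \<sqinter> c = a' \<sqinter> c" by (simp add: meet_assoc)
  moreover have "a \<squnion> (a' \<sqinter> c) = a \<squnion> c'" unfolding c2(2) by (simp add: join_assoc[symmetric] 1)
  moreover have "(a \<squnion> c') \<sqinter> c = a' \<sqinter> c" unfolding a2 by (simp add: meet_assoc 1)
  moreover have "(a \<squnion> c') \<sqinter> b = a' \<sqinter> b" unfolding a2 by (simp add: meet_assoc 1)
  moreover have "b \<squnion> (a' \<sqinter> c) = b \<squnion> c'" unfolding c2(2) by (simp add: join_assoc[symmetric] 1)
  ultimately show ?thesis using ab bc neq by (simp add: left_bad_chain_def)
qed

text \<open>In a \<open>\<D>\<close>-class an element is determined by its \<open>\<L>\<close>- and \<open>\<R>\<close>-components relative to \<open>b\<close>,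
  so one of the two components of a bad chain is bad.\<close>

lemma left_bad_chain_cases:
  assumes bad: "bad_chain S a b c a' c'"
  shows "(\<exists>a' c'. left_bad_chain S a b c a' c') \<or> (\<exists>a' c'. left_bad_chain (dual_alg S) a b c a' c')"
proof (cases "a' \<sqinter> b = b \<squnion> c' \<and> b \<sqinter> a' = c' \<squnion> b")
  case True
  have [simp]: "b \<in> carrier S" "c \<in> carrier S" "a' \<in> carrier S" "c' \<in> carrier S"
    and bc: "nat_ge S b c" and c': "a' \<sqinter> c \<sqinter> a' = c'"
    and neq: "a' \<sqinter> b \<sqinter> a' \<noteq> c' \<squnion> b \<squnion> c'"
    using bad by (auto simp: bad_chain_def)
  have "nat_preorder S c c'" using nat_preorder_meetI[of a' a' c] c' by simp
  then have "nat_preorder S b c'"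
    using nat_ge_imp_preorder[OF _ _ bc] nat_preorder_trans[of b c c'] by simp
  then have "(b \<squnion> c', c' \<squnion> b) \<in> Drel S"
    using Drel_joinI[of b c'] Drel_sym Drel_trans
    by (meson \<open>b \<in> carrier S\<close> \<open>c' \<in> carrier S\<close>)
  then have eq: "(b \<squnion> c') \<sqinter> (c' \<squnion> b) = (c' \<squnion> b) \<squnion> (b \<squnion> c')" by (rule Drel_meet_eq_join)
  have "a' \<sqinter> b \<sqinter> a' = (a' \<sqinter> b) \<sqinter> (b \<sqinter> a')" by (simp add: meet_assoc meet_left_idem)
  also have "\<dots> = (b \<squnion> c') \<sqinter> (c' \<squnion> b)" using True by simp
  also have "\<dots> = c' \<squnion> b \<squnion> c'" unfolding eq by (simp add: join_assoc join_left_idem)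
  finally show ?thesis using neq by simp
next
  case False
  then show ?thesis
    using left_bad_chainI[OF bad]
      skew_lattice.left_bad_chainI[OF dual_skew_lattice bad_chain_dual[OF bad]] by fastforce
qed

text \<open>Since \<open>a1\<close> and \<open>a2\<close> are \<L>-related, \<open>a2\<close> is a
  right identity for everything below \<open>a1\<close>. So meeting with \<open>a2\<close> on the
  left changes the upper end and keeps the \<L>-class, and meeting with \<open>a1\<close> undoes
  it.\<close>

lemma left_mid_meet:
  assumes [simp]: "a1 \<in> carrier S" "a2 \<in> carrier S" "b \<in> carrier S" "c1 \<in> carrier S"
    and a: "a1 \<sqinter> a2 = a1" "a2 \<sqinter> a1 = a2" and x: "left_mid S b a1 c1 x"
  shows "left_mid S b a2 (a2 \<sqinter> c1) (a2 \<sqinter> x)" "a1 \<sqinter> (a2 \<sqinter> x) = x"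
proof -
  have [simp]: "x \<in> carrier S" and xb: "x \<sqinter> b = x" "b \<sqinter> x = b"
    and xa: "a1 \<sqinter> x = x" "x \<sqinter> a1 = x" and xc: "x \<sqinter> c1 = c1" "c1 \<sqinter> x = c1"
    using x by (auto simp: left_mid_def nat_ge_iff_meet)
  have xa2: "x \<sqinter> a2 = x" using a xa by (metis \<open>x \<in> carrier S\<close> assms(1,2) meet_assoc)
  have ca2: "c1 \<sqinter> a2 = c1" using xa2 xc by (metis \<open>x \<in> carrier S\<close> assms(2,4) meet_assoc)
  have ba2: "b \<sqinter> a2 = b" using xa2 xb by (metis \<open>x \<in> carrier S\<close> assms(2,3) meet_assoc)
  show "a1 \<sqinter> (a2 \<sqinter> x) = x" using a xa by (simp add: meet_assoc[symmetric])
  have "b \<sqinter> (a2 \<sqinter> x) = b" using ba2 xb by (simp add: meet_assoc[symmetric])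
  moreover have "c1 \<sqinter> (a2 \<sqinter> x) = c1" using ca2 xc by (simp add: meet_assoc[symmetric])
  moreover have "x \<sqinter> (a2 \<sqinter> c1) = c1" using xa2 xc by (simp add: meet_assoc[symmetric])
  ultimately show "left_mid S b a2 (a2 \<sqinter> c1) (a2 \<sqinter> x)"
    using xb xa2 by (simp add: left_mid_def nat_ge_iff_meet meet_assoc meet_left_idem)
qed

lemma left_mid_join:
  assumes "c1 \<in> carrier S" "c2 \<in> carrier S" "b \<in> carrier S" "a1 \<in> carrier S"
    and "c1 \<sqinter> c2 = c1" "c2 \<sqinter> c1 = c2" and x: "left_mid S b a1 c1 x"
  shows "left_mid S b (a1 \<squnion> c2) c2 (x \<squnion> c2)" "x \<squnion> c2 \<squnion> c1 = x"
proof -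
  \<comment> \<open>Exchanging the operations turns \<L> into \<R>, and reversing them turns it
    back. In \<open>V\<close> the map \<open>_ \<squnion> c2\<close> is thus a left meet, and the
    two ends trade places.\<close>
  define V where "V = flip_alg (dual_alg S)"
  interpret d: skew_lattice "dual_alg S" by (rule dual_skew_lattice)
  interpret V: skew_lattice V unfolding V_def by (rule d.flip_skew_lattice)
  have [simp]: "carrier V = carrier S" "u \<sqinter>\<^bsub>V\<^esub> v = v \<squnion> u" for u v by (simp_all add: V_def)
  have mid: "left_mid V b c a y \<longleftrightarrow> left_mid S b a c y" if "a \<in> carrier S" "c \<in> carrier S" for a c y
    using that assms(3) by (auto simp: left_mid_def V_def d.nat_ge_flip nat_ge_dual
        join_eq_right_iff)
  have "c2 \<squnion> c1 = c1" "c1 \<squnion> c2 = c2" using assms by (simp_all add: join_eq_right_iff)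
  then have "left_mid V b c2 (c2 \<sqinter>\<^bsub>V\<^esub> a1) (c2 \<sqinter>\<^bsub>V\<^esub> x)" "c1 \<sqinter>\<^bsub>V\<^esub> (c2 \<sqinter>\<^bsub>V\<^esub> x) = x"
    using V.left_mid_meet[of c1 c2 b a1 x] assms mid[of a1 c1 x] by simp_all
  then show "left_mid S b (a1 \<squnion> c2) c2 (x \<squnion> c2)" "x \<squnion> c2 \<squnion> c1 = x"
    using mid assms by simp_all
qed

end

text \<open>Negative indices are filled by iterating the right inverse \<open>T'\<close>, so that
  each step forward cancels one \<open>T'\<close>.\<close>

lemma int_orbit:
  assumes "b \<in> E" and T: "\<And>x. x \<in> E \<Longrightarrow> T x \<in> E" and T': "\<And>x. x \<in> E \<Longrightarrow> T' x \<in> E"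
    and inv: "\<And>x. x \<in> E \<Longrightarrow> T (T' x) = x"
  shows "\<exists>t :: int \<Rightarrow> 'a. t 0 = b \<and> (\<forall>k. t k \<in> E \<and> t (k + 1) = T (t k))"
proof -
  define t where "t k = (if k \<ge> 0 then (T ^^ nat k) b else (T' ^^ nat (- k)) b)" for k
  have TE: "(T ^^ m) b \<in> E" "(T' ^^ m) b \<in> E" for m
    by (induction m) (simp_all add: assms)
  have "t (k + 1) = T (t k)" for k
  proof (cases "k \<ge> 0")
    case True
    then show ?thesis by (simp add: t_def nat_add_distrib)
  next
    case False
    define m where "m = nat (- k - 1)"
    have k: "k = - int (Suc m)" using False by (simp add: m_def)
    have "t k = T' ((T' ^^ m) b)" by (simp add: t_def k nat_add_distrib)
    moreover have "t (k + 1) = (T' ^^ m) b" by (simp add: t_def k)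
    ultimately show ?thesis using inv TE by simp
  qed
  moreover have "t k \<in> E" for k using TE by (simp add: t_def)
  moreover have "t 0 = b" by (simp add: t_def)
  ultimately show ?thesis by blast
qed

text \<open>Equality of terms is invariant under shifts, hence depends on the difference of the
  indices. The differences with equal terms are the multiples of the least positive one; \<infinity>
  stands for the case that there is none.\<close>

lemma int_orbit_period:
  fixes t :: "int \<Rightarrow> 'a"
  assumes step: "\<And>k l. t k = t l \<longleftrightarrow> t (k + 1) = t (l + 1)"
  obtains n :: enat where "n \<noteq> 0"
    "\<And>k l. t k = t l \<longleftrightarrow> (case n of enat m \<Rightarrow> int m dvd k - l | \<infinity> \<Rightarrow> k = l)"
proof -
  have shift: "t k = t l \<longleftrightarrow> t (k + d) = t (l + d)" for k l d
  proof (induction d rule: int_induct[where k = 0])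
    case (step1 i)
    then show ?case using step[of "k + i" "l + i"] by (simp add: add.assoc)
  next
    case (step2 i)
    then show ?case using step[of "k + (i - 1)" "l + (i - 1)"] by (simp add: add.assoc)
  qed simp
  have diff: "t k = t l \<longleftrightarrow> t (k - l) = t 0" for k l
    using shift[of k l "- l"] by simp
  show ?thesis
  proof (cases "\<exists>m>0. t (int m) = t 0")
    case False
    have "k = l" if "t k = t l" for k l
    proof (rule ccontr)
      assume "k \<noteq> l"
      moreover have "t (k - l) = t 0" "t (l - k) = t 0" using that diff by metis+
      ultimately show False
        using False[simplified, rule_format, of "nat (k - l)"]
          False[simplified, rule_format, of "nat (l - k)"] by (cases "k > l") auto
    qed
    then show ?thesis using that[of \<infinity>] by auto
  next
    case True
    define n where "n = (LEAST m. m > 0 \<and> t (int m) = t 0)"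
    have n: "n > 0" "t (int n) = t 0" using LeastI_ex[OF True] by (auto simp: n_def)
    have min: "t (int m) \<noteq> t 0" if "0 < m" "m < n" for m
      using not_less_Least[of m "\<lambda>m. m > 0 \<and> t (int m) = t 0"] that by (auto simp: n_def)
    have per1: "t (x + int n) = t x" for x using shift[of "int n" 0 x] n by (simp add: add.commute)
    have per: "t (x + int n * q) = t x" for x q
    proof (induction q rule: int_induct[where k = 0])
      case (step1 i)
      then show ?case using per1[of "x + int n * i"] by (simp add: algebra_simps)
    next
      case (step2 i)
      then show ?case using per1[of "x + int n * (i - 1)"] by (simp add: algebra_simps)
    qed simp
    have "t d = t 0 \<longleftrightarrow> int n dvd d" for d
    proof
      assume "t d = t 0"
      \<comment> \<open>The remainder is a period smaller than the least positive one, hence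
        0.\<close>
      then have "t (d mod int n) = t 0"
        using per[of "d mod int n" "d div int n"] by (simp add: mult.commute)
      then have "\<not> 0 < d mod int n"
        using min[of "nat (d mod int n)"] n(1) by (auto simp: nat_less_iff)
      then show "int n dvd d"
        using n(1) pos_mod_sign[of "int n" d] unfolding dvd_eq_mod_eq_0 by linarith
    next
      assume "int n dvd d"
      then show "t d = t 0" using per[of 0] by auto
    qed
    then show ?thesis using that[of "enat n"] n(1) diff by (auto simp: zero_enat_def)
  qed
qed

section \<open>The algebras \<open>X\<^sub>n\<close>\<close>

text \<open>Works with an injective homomorphism from \<open>X\<close> into \<open>S\<close>, the
  inverse of the isomorphism in the definition; its image is the subalgebra.\<close>

lemma has_subalgebra_isoI:
  assumes inj: "inj_on g (carrier X)" and sub: "g ` carrier X \<subseteq> carrier S"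
    and hom: "\<And>x y. x \<in> carrier X \<Longrightarrow> y \<in> carrier X \<Longrightarrow>
      x \<squnion>\<^bsub>X\<^esub> y \<in> carrier X \<and> x \<sqinter>\<^bsub>X\<^esub> y \<in> carrier X \<and>
      g (x \<squnion>\<^bsub>X\<^esub> y) = g x \<squnion>\<^bsub>S\<^esub> g y \<and> g (x \<sqinter>\<^bsub>X\<^esub> y) = g x \<sqinter>\<^bsub>S\<^esub> g y"
  shows "has_subalgebra_iso S X"
proof -
  define T where "T = g ` carrier X"
  define h where "h = the_inv_into (carrier X) g"
  have hg: "h (g x) = x" if "x \<in> carrier X" for x
    using inj that by (simp add: h_def the_inv_into_f_f)
  have "subalgebra T S"
    unfolding subalgebra_def T_def using sub hom by (auto simp: image_iff) metis+
  moreover have "isomorphic (S\<lparr>carrier := T\<rparr>) X"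
    unfolding isomorphic_def
  proof (intro exI[of _ h] conjI ballI)
    show "bij_betw h (carrier (S\<lparr>carrier := T\<rparr>)) (carrier X)"
      using bij_betw_the_inv_into[of g "carrier X" T] inj by (simp add: h_def T_def bij_betw_def)
    fix x y assume "x \<in> carrier (S\<lparr>carrier := T\<rparr>)" "y \<in> carrier (S\<lparr>carrier := T\<rparr>)"
    then obtain u v where uv: "u \<in> carrier X" "v \<in> carrier X" "x = g u" "y = g v"
      by (auto simp: T_def)
    show "h (x \<squnion>\<^bsub>S\<lparr>carrier := T\<rparr>\<^esub> y) = h x \<squnion>\<^bsub>X\<^esub> h y"
      "h (x \<sqinter>\<^bsub>S\<lparr>carrier := T\<rparr>\<^esub> y) = h x \<sqinter>\<^bsub>X\<^esub> h y"
      using hg[of "u \<squnion>\<^bsub>X\<^esub> v"] hg[of "u \<sqinter>\<^bsub>X\<^esub> v"] hg[of u] hg[of v] hom[of u v] uv by simp_all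
  qed
  ultimately show ?thesis by (auto simp: has_subalgebra_iso_def)
qed

text \<open>Closure of \<open>X\<close> under its operations comes from the subalgebra
  \<open>T\<close>, through the isomorphism \<open>h\<close>.\<close>

lemma has_subalgebra_isoE:
  assumes "has_subalgebra_iso S X"
  obtains g where "inj_on g (carrier X)" "g ` carrier X \<subseteq> carrier S"
    "\<And>x y. x \<in> carrier X \<Longrightarrow> y \<in> carrier X \<Longrightarrow> x \<squnion>\<^bsub>X\<^esub> y \<in> carrier X \<and> x \<sqinter>\<^bsub>X\<^esub> y \<in> carrier X"
    "\<And>x y. x \<in> carrier X \<Longrightarrow> y \<in> carrier X \<Longrightarrow> g (x \<squnion>\<^bsub>X\<^esub> y) = g x \<squnion>\<^bsub>S\<^esub> g y"
    "\<And>x y. x \<in> carrier X \<Longrightarrow> y \<in> carrier X \<Longrightarrow> g (x \<sqinter>\<^bsub>X\<^esub> y) = g x \<sqinter>\<^bsub>S\<^esub> g y"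
proof -
  obtain T h where T: "subalgebra T S" and bij: "bij_betw h T (carrier X)"
    and h: "\<And>x y. x \<in> T \<Longrightarrow> y \<in> T \<Longrightarrow> h (x \<squnion>\<^bsub>S\<^esub> y) = h x \<squnion>\<^bsub>X\<^esub> h y"
      "\<And>x y. x \<in> T \<Longrightarrow> y \<in> T \<Longrightarrow> h (x \<sqinter>\<^bsub>S\<^esub> y) = h x \<sqinter>\<^bsub>X\<^esub> h y"
    using assms by (auto simp: has_subalgebra_iso_def isomorphic_def)
  have inj: "inj_on h T" using bij by (simp add: bij_betw_def)
  define g where "g = the_inv_into T h"
  have g: "bij_betw g (carrier X) T" unfolding g_def by (rule bij_betw_the_inv_into[OF bij])
  have hg: "h (g x) = x" "g x \<in> T" if "x \<in> carrier X" for x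
    using that bij g by (auto simp: g_def bij_betw_def f_the_inv_into_f)
  have gh: "g (h x) = x" "h x \<in> carrier X" if "x \<in> T" for x
    using that bij by (auto simp: g_def bij_betw_def the_inv_into_f_f)
  have TT: "x \<squnion>\<^bsub>S\<^esub> y \<in> T" "x \<sqinter>\<^bsub>S\<^esub> y \<in> T" if "x \<in> T" "y \<in> T" for x y
    using T that by (auto simp: subalgebra_def)
  show ?thesis
  proof (rule that[of g])
    show "inj_on g (carrier X)" using g by (simp add: bij_betw_def)
    show "g ` carrier X \<subseteq> carrier S" using g T by (auto simp: bij_betw_def subalgebra_def)
    fix x y assume xy: "x \<in> carrier X" "y \<in> carrier X"
    show "x \<squnion>\<^bsub>X\<^esub> y \<in> carrier X \<and> x \<sqinter>\<^bsub>X\<^esub> y \<in> carrier X"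
      using h[of "g x" "g y"] hg xy TT[of "g x" "g y"] gh(2) by metis
    show "g (x \<squnion>\<^bsub>X\<^esub> y) = g x \<squnion>\<^bsub>S\<^esub> g y"
      using h(1)[of "g x" "g y"] hg[OF xy(1)] hg[OF xy(2)] gh(1)[of "g x \<squnion>\<^bsub>S\<^esub> g y"] TT by simp
    show "g (x \<sqinter>\<^bsub>X\<^esub> y) = g x \<sqinter>\<^bsub>S\<^esub> g y"
      using h(2)[of "g x" "g y"] hg[OF xy(1)] hg[OF xy(2)] gh(1)[of "g x \<sqinter>\<^bsub>S\<^esub> g y"] TT by simp
  qed
qed

text \<open>The same injection serves, as both algebras have their operations reversed.\<close>

lemma has_subalgebra_iso_dual:
  assumes "has_subalgebra_iso S X"
  shows "has_subalgebra_iso (dual_alg S) (dual_alg X)"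
proof -
  obtain g where g: "inj_on g (carrier X)" "g ` carrier X \<subseteq> carrier S"
    "\<And>x y. x \<in> carrier X \<Longrightarrow> y \<in> carrier X \<Longrightarrow> x \<squnion>\<^bsub>X\<^esub> y \<in> carrier X \<and> x \<sqinter>\<^bsub>X\<^esub> y \<in> carrier X"
    "\<And>x y. x \<in> carrier X \<Longrightarrow> y \<in> carrier X \<Longrightarrow> g (x \<squnion>\<^bsub>X\<^esub> y) = g x \<squnion>\<^bsub>S\<^esub> g y"
    "\<And>x y. x \<in> carrier X \<Longrightarrow> y \<in> carrier X \<Longrightarrow> g (x \<sqinter>\<^bsub>X\<^esub> y) = g x \<sqinter>\<^bsub>S\<^esub> g y"
    using has_subalgebra_isoE[OF assms] by blast
  show ?thesis
    by (rule has_subalgebra_isoI[of g]) (use g in simp_all)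
qed

section \<open>Index arithmetic and operation tables of X_n\<close>

lemma b_elem_finite_eq_iff: "b_elem (enat n) i = b_elem (enat n) j \<longleftrightarrow> 2 * int n dvd i - j"
  by (simp add: mod_eq_dvd_iff)

lemma b_elem_shift: "b_elem n i = b_elem n j \<Longrightarrow> b_elem n (i + d) = b_elem n (j + d)"
  by (cases n) (auto simp: mod_eq_dvd_iff)

text \<open>The modulus \<open>2n\<close> is even, so parity belongs to the element and not just to
  the index.\<close>

lemma b_elem_parity: "b_elem n i = b_elem n j \<Longrightarrow> even i \<longleftrightarrow> even j"
proof (cases n)
  case (enat m)
  moreover assume "b_elem n i = b_elem n j"
  ultimately have "2 * int m dvd i - j" by (simp add: mod_eq_dvd_iff)
  then have "even (i - j)" by (meson dvd_mult_left)
  then show ?thesis by simp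
qed simp

lemma X_gt_b_elem [simp]:
  "X_gt Xa1 (b_elem n i) \<longleftrightarrow> odd i" "X_gt Xa2 (b_elem n i) \<longleftrightarrow> even i"
  "X_gt (b_elem n i) Xc1 \<longleftrightarrow> odd i" "X_gt (b_elem n i) Xc2 \<longleftrightarrow> even i"
  by (cases n; simp add: dvd_mod_iff)+

lemma class_of_b_elem [simp]: "class_of (b_elem n i) = ClassB"
  by (cases n) simp_all

text \<open>Evaluates the descriptions in \<open>X_meet\<close> and \<open>X_join\<close> for cosets
  indexed by integers. Uniqueness is checked for every index, as for finite \<open>n\<close> one
  coset has many.\<close>

lemma the_coset_eqI:
  assumes "\<exists>k. x \<in> F k \<and> v \<in> F k" "P v"
    and "\<And>y k. x \<in> F k \<Longrightarrow> y \<in> F k \<Longrightarrow> P y \<Longrightarrow> y = v"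
  shows "(THE y. (\<exists>Y\<in>{F k | k. True}. x \<in> Y \<and> y \<in> Y) \<and> P y) = v"
  using assms by (intro the_equality) blast+

lemma X_meet_a1_b: "X_meet n Xa1 (b_elem n i) = b_elem n (if odd i then i else i - 1)"
proof -
  have "\<exists>k. b_elem n i \<in> {b_elem n (2 * k - 1), b_elem n (2 * k)} \<and>
      b_elem n (if odd i then i else i - 1) \<in> {b_elem n (2 * k - 1), b_elem n (2 * k)}"
    \<comment> \<open>Both \<open>2k - 1\<close> and \<open>2k\<close> give this \<open>k\<close>,
      so it indexes the coset of \<open>b_elem n i\<close> for either parity.\<close>
    by (rule exI[of _ "(i + 1) div 2"]) (auto elim!: evenE oddE simp: algebra_simps)
  moreover have "y = b_elem n (if odd i then i else i - 1)"
    if "b_elem n i \<in> {b_elem n (2 * k - 1), b_elem n (2 * k)}"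
      "y \<in> {b_elem n (2 * k - 1), b_elem n (2 * k)}" "X_gt Xa1 y" for y k
    using that b_elem_parity[of n i "2 * k"] b_elem_parity[of n i "2 * k - 1"]
      b_elem_shift[of n i "2 * k" "- 1"] by auto
  ultimately show ?thesis
    unfolding X_meet_def by (simp only: class_of.simps class_of_b_elem class_gt.simps if_True
      X_cosets.simps) (rule the_coset_eqI[where F = "\<lambda>k. {b_elem n (2 * k - 1), b_elem n (2 * k)}"]; simp)
qed

lemma X_meet_a2_b: "X_meet n Xa2 (b_elem n i) = b_elem n (if even i then i else i + 1)"
proof -
  have "\<exists>k. b_elem n i \<in> {b_elem n (2 * k - 1), b_elem n (2 * k)} \<and>
      b_elem n (if even i then i else i + 1) \<in> {b_elem n (2 * k - 1), b_elem n (2 * k)}"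
    by (rule exI[of _ "(i + 1) div 2"]) (auto elim!: evenE oddE simp: algebra_simps)
  moreover have "y = b_elem n (if even i then i else i + 1)"
    if "b_elem n i \<in> {b_elem n (2 * k - 1), b_elem n (2 * k)}"
      "y \<in> {b_elem n (2 * k - 1), b_elem n (2 * k)}" "X_gt Xa2 y" for y k
    using that b_elem_parity[of n i "2 * k"] b_elem_parity[of n i "2 * k - 1"]
      b_elem_shift[of n i "2 * k - 1" 1] by auto
  ultimately show ?thesis
    unfolding X_meet_def by (simp only: class_of.simps class_of_b_elem class_gt.simps if_True
      X_cosets.simps) (rule the_coset_eqI[where F = "\<lambda>k. {b_elem n (2 * k - 1), b_elem n (2 * k)}"]; simp)
qed

lemma X_join_b_c1: "X_join n (b_elem n i) Xc1 = b_elem n (if odd i then i else i + 1)"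
proof -
  have "\<exists>k. b_elem n i \<in> {b_elem n (2 * k), b_elem n (2 * k + 1)} \<and>
      b_elem n (if odd i then i else i + 1) \<in> {b_elem n (2 * k), b_elem n (2 * k + 1)}"
    \<comment> \<open>The cosets of the lower class pair \<open>2k\<close> with
      \<open>2k + 1\<close>, hence the other rounding.\<close>
    by (rule exI[of _ "i div 2"]) (auto elim!: evenE oddE simp: algebra_simps)
  moreover have "y = b_elem n (if odd i then i else i + 1)"
    if "b_elem n i \<in> {b_elem n (2 * k), b_elem n (2 * k + 1)}"
      "y \<in> {b_elem n (2 * k), b_elem n (2 * k + 1)}" "X_gt y Xc1" for y k
    using that b_elem_parity[of n i "2 * k"] b_elem_parity[of n i "2 * k + 1"]
      b_elem_shift[of n i "2 * k" 1] by auto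
  ultimately show ?thesis
    unfolding X_join_def by (simp only: class_of.simps class_of_b_elem class_gt.simps if_True
      X_cosets.simps) (rule the_coset_eqI[where F = "\<lambda>k. {b_elem n (2 * k), b_elem n (2 * k + 1)}"]; simp)
qed

lemma X_join_b_c2: "X_join n (b_elem n i) Xc2 = b_elem n (if even i then i else i - 1)"
proof -
  have "\<exists>k. b_elem n i \<in> {b_elem n (2 * k), b_elem n (2 * k + 1)} \<and>
      b_elem n (if even i then i else i - 1) \<in> {b_elem n (2 * k), b_elem n (2 * k + 1)}"
    by (rule exI[of _ "i div 2"]) (auto elim!: evenE oddE simp: algebra_simps)
  moreover have "y = b_elem n (if even i then i else i - 1)"
    if "b_elem n i \<in> {b_elem n (2 * k), b_elem n (2 * k + 1)}"
      "y \<in> {b_elem n (2 * k), b_elem n (2 * k + 1)}" "X_gt y Xc2" for y k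
    using that b_elem_parity[of n i "2 * k"] b_elem_parity[of n i "2 * k + 1"]
      b_elem_shift[of n i "2 * k + 1" "- 1"] by auto
  ultimately show ?thesis
    unfolding X_join_def by (simp only: class_of.simps class_of_b_elem class_gt.simps if_True
      X_cosets.simps) (rule the_coset_eqI[where F = "\<lambda>k. {b_elem n (2 * k), b_elem n (2 * k + 1)}"]; simp)
qed

lemma X_meet_class: "\<not> class_gt (class_of x) (class_of y) \<Longrightarrow> X_meet n x y = x"
  by (simp add: X_meet_def)

lemma X_join_class: "\<not> class_gt (class_of x) (class_of y) \<Longrightarrow> X_join n x y = y"
  by (simp add: X_join_def)

lemma X_meet_c:
  "X_meet n Xa1 Xc1 = Xc1" "X_meet n Xa1 Xc2 = Xc1"
  "X_meet n Xa2 Xc1 = Xc2" "X_meet n Xa2 Xc2 = Xc2"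
  "X_meet n (b_elem n i) Xc1 = (if odd i then Xc1 else Xc2)"
  "X_meet n (b_elem n i) Xc2 = (if odd i then Xc1 else Xc2)"
  by (auto simp: X_meet_def intro!: the_equality)

lemma X_join_a:
  "X_join n Xa1 Xc1 = Xa1" "X_join n Xa1 Xc2 = Xa2"
  "X_join n Xa2 Xc1 = Xa1" "X_join n Xa2 Xc2 = Xa2"
  "X_join n Xa1 (b_elem n i) = (if odd i then Xa1 else Xa2)"
  "X_join n Xa2 (b_elem n i) = (if odd i then Xa1 else Xa2)"
  by (auto simp: X_join_def intro!: the_equality)

text \<open>For \<open>n = 0\<close> reduction modulo 0 is the identity, so \<open>b_elem\<close>
  would take every value \<open>Xb i\<close> while \<open>X_B\<close> is empty.\<close>

lemma X_B_eq: "n \<noteq> 0 \<Longrightarrow> X_B n = range (b_elem n)"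
proof (cases n)
  case (enat m)
  assume "n \<noteq> 0"
  with enat have "m > 0" by (simp add: zero_enat_def)
  have "Xb i \<in> range (b_elem n)" if "i \<in> {1..2 * int m}" for i
    using that \<open>m > 0\<close> enat by (intro image_eqI[of _ _ i]) simp_all
  moreover have "b_elem n i \<in> X_B n" for i
    using \<open>m > 0\<close> enat by (auto intro!: imageI zless_imp_add1_zle)
  ultimately show ?thesis using enat by auto
qed auto

lemma X_alg_simps [simp]:
  "x \<squnion>\<^bsub>X_alg n\<^esub> y = X_join n x y"
  "x \<sqinter>\<^bsub>X_alg n\<^esub> y = X_meet n x y"
  by (simp_all add: X_alg_def)

lemma carrier_X_alg:
  "n \<noteq> 0 \<Longrightarrow> carrier (X_alg n) = {Xa1, Xa2, Xc1, Xc2} \<union> range (b_elem n)"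
  by (auto simp: X_alg_def X_B_eq)

lemma X_alg_cases:
  assumes "x \<in> carrier (X_alg n)" "n \<noteq> 0"
  obtains "x = Xa1" | "x = Xa2" | i where "x = b_elem n i" | "x = Xc1" | "x = Xc2"
  using assms by (auto simp: carrier_X_alg)

lemmas X_ops = X_meet_a1_b X_meet_a2_b X_join_b_c1 X_join_b_c2 X_meet_c X_join_a
  X_meet_class X_join_class

lemma X_alg_closed:
  assumes "x \<in> carrier (X_alg n)" "y \<in> carrier (X_alg n)" "n \<noteq> 0"
  shows "X_join n x y \<in> carrier (X_alg n)" "X_meet n x y \<in> carrier (X_alg n)"
  by (rule X_alg_cases[OF assms(1,3)]; rule X_alg_cases[OF assms(2,3)];
      use assms in \<open>simp add: X_ops carrier_X_alg\<close>)+

section \<open>The copy of X_n generated by a one-sided bad chain\<close>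

fun X_map :: "'a \<Rightarrow> 'a \<Rightarrow> (int \<Rightarrow> 'a) \<Rightarrow> 'a \<Rightarrow> 'a \<Rightarrow> xelem \<Rightarrow> 'a" where
  "X_map a1 a2 \<beta> c1 c2 Xa1 = a1"
| "X_map a1 a2 \<beta> c1 c2 Xa2 = a2"
| "X_map a1 a2 \<beta> c1 c2 (Xb i) = \<beta> i"
| "X_map a1 a2 \<beta> c1 c2 Xc1 = c1"
| "X_map a1 a2 \<beta> c1 c2 Xc2 = c2"

text \<open>For indices of equal parity the factor 2 cancels from the period \<open>2n\<close>. What
  remains is the equality pattern found in \<open>int_orbit_period\<close>.\<close>

lemma b_elem_double:
  "b_elem n (2 * k + d) = b_elem n (2 * l + d) \<longleftrightarrow> (case n of enat m \<Rightarrow> int m dvd k - l | \<infinity> \<Rightarrow> k = l)"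
proof (cases n)
  case (enat m)
  have "2 * int m dvd 2 * (k - l) \<longleftrightarrow> int m dvd k - l" by (subst dvd_mult_cancel_left) simp
  then show ?thesis unfolding enat b_elem_finite_eq_iff by (simp add: algebra_simps)
qed simp

context skew_lattice
begin

lemma left_bad_chain_embeds:
  assumes "left_bad_chain S a1 b c1 a2 c2"
  shows "\<exists>n\<ge>2. has_subalgebra_iso S (X_alg n)"
proof -
  have [simp]: "a1 \<in> carrier S" "a2 \<in> carrier S" "b \<in> carrier S" "c1 \<in> carrier S" "c2 \<in> carrier S"
    and ab: "nat_ge S a1 b" and bc: "nat_ge S b c1"
    and aa [simp]: "a1 \<sqinter> a2 = a1" "a2 \<sqinter> a1 = a2" and cc [simp]: "c1 \<sqinter> c2 = c1" "c2 \<sqinter> c1 = c2"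
    and a2 [simp]: "a1 \<squnion> c2 = a2" and c2 [simp]: "a2 \<sqinter> c1 = c2"
    and neq: "a2 \<sqinter> b \<noteq> b \<squnion> c2"
    using assms by (auto simp: left_bad_chain_def)
  have ab' [simp]: "a1 \<squnion> b = a1" "b \<squnion> a1 = a1" "a1 \<sqinter> b = b" "b \<sqinter> a1 = b"
    using ab nat_ge_iff_meet[of a1 b] by (auto simp: nat_ge_def)
  have bc' [simp]: "b \<squnion> c1 = b" "c1 \<squnion> b = b" "b \<sqinter> c1 = c1" "c1 \<sqinter> b = c1"
    using bc nat_ge_iff_meet[of b c1] by (auto simp: nat_ge_def)
  have "nat_ge S a1 c1" using ab bc by (rule nat_ge_trans[rotated 3]) simp_all
  then have ac' [simp]: "a1 \<squnion> c1 = a1" "c1 \<squnion> a1 = a1" "a1 \<sqinter> c1 = c1" "c1 \<sqinter> a1 = c1"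
    using nat_ge_iff_meet[of a1 c1] by (auto simp: nat_ge_def)
  have cj [simp]: "c1 \<squnion> c2 = c2" "c2 \<squnion> c1 = c1" by (simp_all add: join_eq_right_iff)
  have [simp]: "a1 \<sqinter> c2 = c1" using meet_assoc[of a1 a2 c1] by simp
  have [simp]: "a2 \<squnion> c1 = a1" using join_assoc[of a1 c2 c1] by simp

  \<comment> \<open>\<open>E1\<close> will hold the terms of odd index and \<open>E2\<close> those
    of even index. Meets with \<open>a2\<close> and \<open>a1\<close>, and joins with
    \<open>c2\<close> and \<open>c1\<close>, give two pairs of mutually inverse bijections between
    them.\<close>
  define E1 where "E1 = {x. left_mid S b a1 c1 x}"
  define E2 where "E2 = {x. left_mid S b a2 c2 x}"
  have bE1: "b \<in> E1" using ab bc by (simp add: E1_def left_mid_def)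
  have f: "a2 \<sqinter> x \<in> E2" "a1 \<sqinter> (a2 \<sqinter> x) = x" if "x \<in> E1" for x
    using left_mid_meet[of a1 a2 b c1 x] that by (simp_all add: E1_def E2_def)
  have f': "a1 \<sqinter> x \<in> E1" "a2 \<sqinter> (a1 \<sqinter> x) = x" if "x \<in> E2" for x
    using left_mid_meet[of a2 a1 b c2 x] that by (simp_all add: E1_def E2_def)
  have g: "x \<squnion> c2 \<in> E2" "x \<squnion> c2 \<squnion> c1 = x" if "x \<in> E1" for x
    using left_mid_join[of c1 c2 b a1 x] that by (simp_all add: E1_def E2_def)
  have g': "x \<squnion> c1 \<in> E1" "x \<squnion> c1 \<squnion> c2 = x" if "x \<in> E2" for x
    using left_mid_join[of c2 c1 b a2 x] that by (simp_all add: E1_def E2_def)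

  \<comment> \<open>Only the odd terms are generated: one step of \<open>t\<close> is a meet with
    \<open>a2\<close> followed by a join with \<open>c1\<close>, and the inverse undoes these in
    reverse order.\<close>
  have "\<exists>t. t 0 = b \<and> (\<forall>k :: int. t k \<in> E1 \<and> t (k + 1) = (a2 \<sqinter> t k) \<squnion> c1)"
    using bE1 by (rule int_orbit[where T' = "\<lambda>x. a1 \<sqinter> (x \<squnion> c2)"]) (simp_all add: f f' g g')
  then obtain t :: "int \<Rightarrow> 'a" where t0: "t 0 = b" and tE: "\<And>k. t k \<in> E1"
    and tS: "\<And>k. t (k + 1) = (a2 \<sqinter> t k) \<squnion> c1"
    by blast
  have "t k = t l \<longleftrightarrow> t (k + 1) = t (l + 1)" for k l
    unfolding tS using f[OF tE] g'(2) by metis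
  then obtain n where n0: "n \<noteq> 0"
    and per: "\<And>k l. t k = t l \<longleftrightarrow> (case n of enat m \<Rightarrow> int m dvd k - l | \<infinity> \<Rightarrow> k = l)"
    using int_orbit_period[of t] by blast
  \<comment> \<open>If they were equal, joining with \<open>c2\<close> would turn
    \<open>(a2 \<sqinter> b) \<squnion> c1 = b\<close> into
    \<open>a2 \<sqinter> b = b \<squnion> c2\<close>. This is where the inequation excludes
    \<open>n = 1\<close>.\<close>
  have "t 1 \<noteq> t 0"
    using tS[of 0] t0 neq g'(2)[OF f(1)[OF bE1]] by auto
  then have "n \<noteq> 1" using per[of 1 0] by (auto simp: one_enat_def)
  then have n2: "n \<ge> 2"
    using n0 by (cases n) (auto simp: zero_enat_def one_enat_def numeral_eq_enat)

  \<comment> \<open>The offsets put \<open>b\<close> at index 1 and make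
    \<open>\<beta> (2 * k)\<close> the image under \<open>a2\<close> of
    \<open>\<beta> (2 * k - 1)\<close>, in agreement with the cosets of X_n.\<close>
  define \<beta> where "\<beta> i = (if odd i then t ((i - 1) div 2) else a2 \<sqinter> t (i div 2 - 1))" for i
  have \<beta>_odd: "\<beta> (2 * k + 1) = t k" "\<beta> (1 + 2 * k) = t k" and \<beta>_even: "\<beta> (2 * k) = a2 \<sqinter> t (k - 1)" for k
    by (simp_all add: \<beta>_def)
  have \<beta>E: "odd i \<Longrightarrow> \<beta> i \<in> E1" "even i \<Longrightarrow> \<beta> i \<in> E2" for i
    using tE f(1)[OF tE] by (simp_all add: \<beta>_def)
  have tS': "t k = (a2 \<sqinter> t (k - 1)) \<squnion> c1" for k using tS[of "k - 1"] by simp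
  have \<beta>_a: "a1 \<sqinter> \<beta> i = \<beta> (if odd i then i else i - 1)" "a2 \<sqinter> \<beta> i = \<beta> (if even i then i else i + 1)" for i
  proof -
    have "even i \<Longrightarrow> a1 \<sqinter> \<beta> i = \<beta> (i - 1)"
      using \<beta>_odd[of "i div 2 - 1"] f(2)[OF tE] by (auto simp: \<beta>_even elim!: evenE)
    moreover have "odd i \<Longrightarrow> a2 \<sqinter> \<beta> i = \<beta> (i + 1)"
      using \<beta>_even[of "(i + 1) div 2"] by (auto simp: \<beta>_odd add.commute elim!: oddE)
    ultimately show "a1 \<sqinter> \<beta> i = \<beta> (if odd i then i else i - 1)" "a2 \<sqinter> \<beta> i = \<beta> (if even i then i else i + 1)"
      using \<beta>E[of i] by (auto simp: E1_def E2_def left_mid_def nat_ge_iff_meet)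
  qed
  have \<beta>_c: "\<beta> i \<squnion> c1 = \<beta> (if odd i then i else i + 1)" "\<beta> i \<squnion> c2 = \<beta> (if even i then i else i - 1)" for i
  proof -
    have "even i \<Longrightarrow> \<beta> i \<squnion> c1 = \<beta> (i + 1)"
      using \<beta>_odd[of "i div 2"] tS'[of "i div 2"] by (auto simp: \<beta>_even elim!: evenE)
    moreover have "odd i \<Longrightarrow> \<beta> i \<squnion> c2 = \<beta> (i - 1)"
      using \<beta>_even[of "i div 2"] tS'[of "i div 2"] g'(2)[OF f(1)[OF tE]] by (auto simp: \<beta>_odd add.commute elim!: oddE)
    ultimately show "\<beta> i \<squnion> c1 = \<beta> (if odd i then i else i + 1)" "\<beta> i \<squnion> c2 = \<beta> (if even i then i else i - 1)"
      using \<beta>E[of i] by (auto simp: E1_def E2_def left_mid_def nat_ge_def)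
  qed

  have \<beta>_mid: "\<beta> i \<in> carrier S" "\<beta> i \<sqinter> b = \<beta> i" "b \<sqinter> \<beta> i = b" for i
    using \<beta>E[of i] by (auto simp: E1_def E2_def left_mid_def)
  note [simp] = \<beta>_mid(1)
  have \<beta>_ge: "odd i \<Longrightarrow> nat_ge S a1 (\<beta> i)" "even i \<Longrightarrow> nat_ge S a2 (\<beta> i)"
    "odd i \<Longrightarrow> nat_ge S (\<beta> i) c1" "even i \<Longrightarrow> nat_ge S (\<beta> i) c2" for i
    using \<beta>E[of i] by (auto simp: E1_def E2_def left_mid_def)
  have \<beta>\<beta>: "\<beta> i \<sqinter> \<beta> j = \<beta> i" for i j
    using \<beta>_mid[of i] \<beta>_mid[of j] meet_assoc[of "\<beta> i" b "\<beta> j"] by simp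
  have \<beta>a: "\<beta> i \<sqinter> a1 = \<beta> i" "\<beta> i \<sqinter> a2 = \<beta> i" for i
  proof -
    have "\<beta> i \<sqinter> a1 = \<beta> i \<or> \<beta> i \<sqinter> a2 = \<beta> i"
      using \<beta>_ge[of i] by (auto simp: nat_ge_iff_meet)
    then show "\<beta> i \<sqinter> a1 = \<beta> i" "\<beta> i \<sqinter> a2 = \<beta> i"
      using meet_assoc[of "\<beta> i" a1 a2] meet_assoc[of "\<beta> i" a2 a1] by auto
  qed
  have c\<beta>: "c1 \<sqinter> \<beta> i = c1" "c2 \<sqinter> \<beta> i = c2" for i
  proof -
    have "c1 \<sqinter> \<beta> i = c1 \<or> c2 \<sqinter> \<beta> i = c2"
      using \<beta>_ge[of i] by (auto simp: nat_ge_iff_meet)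
    then show "c1 \<sqinter> \<beta> i = c1" "c2 \<sqinter> \<beta> i = c2"
      using meet_assoc[of c1 c2 "\<beta> i"] meet_assoc[of c2 c1 "\<beta> i"] by auto
  qed
  have ca: "c1 \<sqinter> a2 = c1" "c2 \<sqinter> a1 = c2" "c2 \<sqinter> a2 = c2" "a2 \<sqinter> c2 = c2"
    using meet_assoc[of c1 a1 a2] meet_assoc[of c2 c1 a1] meet_assoc[of c2 c1 a2]
      meet_assoc[of a2 a2 c1] by simp_all
  have \<beta>c: "\<beta> i \<sqinter> c1 = (if odd i then c1 else c2)" "\<beta> i \<sqinter> c2 = (if odd i then c1 else c2)" for i
    using \<beta>_ge[of i] meet_assoc[of "\<beta> i" a2 c1] meet_assoc[of "\<beta> i" a1 c2] \<beta>a[of i]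
    by (auto simp: nat_ge_iff_meet)
  have a\<beta>: "a1 \<squnion> \<beta> i = (if odd i then a1 else a2)" "a2 \<squnion> \<beta> i = (if odd i then a1 else a2)" for i
    using \<beta>_ge[of i] join_assoc[of a1 c2 "\<beta> i"] join_assoc[of a2 c1 "\<beta> i"]
    by (auto simp: nat_ge_def)

  \<comment> \<open>If \<open>c1 = c2\<close>, then also \<open>a1 = a2\<close>, and both sides of
    the inequation become \<open>b\<close>.\<close>
  have c12: "c1 \<noteq> c2"
  proof
    assume "c1 = c2"
    then have "a2 = a1" using a2 ac'(1) by metis
    then show False using neq bc'(1) ab'(3) \<open>c1 = c2\<close> by metis
  qed
  have a12: "a1 \<noteq> a2" using c12 c2 ac' by metis
  have "a1 \<noteq> b" using neq aa a2 by metis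
  have "b \<noteq> c1" using neq c2 cj by metis
  have ab_ne: "a1 \<sqinter> b \<noteq> a1" "a2 \<sqinter> b \<noteq> a2"
    using \<open>a1 \<noteq> b\<close> meet_assoc[of a1 a2 b] by auto
  have cb: "c1 \<sqinter> b = c1" "c2 \<sqinter> b = c2" using meet_assoc[of c2 c1 b] by simp_all
  have bc_ne: "b \<sqinter> c1 \<noteq> b" "b \<sqinter> c2 \<noteq> b"
    using \<open>b \<noteq> c1\<close> meet_assoc[of b c2 c1] by auto
  \<comment> \<open>The meet of \<open>\<beta> i\<close> with \<open>c1\<close> reveals the parity
    of \<open>i\<close>.\<close>
  have par: "even i \<longleftrightarrow> even j" if "\<beta> i = \<beta> j" for i j
    using \<beta>c(1)[of i] \<beta>c(1)[of j] that c12 by metis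
  have \<beta>_iff: "\<beta> i = \<beta> j \<longleftrightarrow> b_elem n i = b_elem n j" for i j
  proof (cases "even i \<longleftrightarrow> even j")
    case False
    then show ?thesis using par b_elem_parity by blast
  next
    case True
    show ?thesis
    proof (cases "even i")
      case False
      then obtain k l where "i = 2 * k + 1" "j = 2 * l + 1" using True by (meson oddE)
      then show ?thesis by (simp only: \<beta>_odd b_elem_double per)
    next
      case even: True
      then obtain k l where kl: "i = 2 * k" "j = 2 * l" using True by (meson evenE)
      \<comment> \<open>Meeting with \<open>a2\<close> is injective on \<open>E1\<close>, so even
        terms have the same equality pattern as odd ones.\<close>
      have "\<beta> i = \<beta> j \<longleftrightarrow> t (k - 1) = t (l - 1)"
        unfolding kl \<beta>_even using f(2)[OF tE] by metis
      moreover have "k - 1 - (l - 1) = k - l" "k - 1 = l - 1 \<longleftrightarrow> k = l" by simp_all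
      ultimately show ?thesis
        using per[of "k - 1" "l - 1"] b_elem_double[of n k 0 l] kl by (simp only: add_0_right)
    qed
  qed

  define h where "h = X_map a1 a2 \<beta> c1 c2"
  have h [simp]: "h Xa1 = a1" "h Xa2 = a2" "h Xc1 = c1" "h Xc2 = c2" by (simp_all add: h_def)
  \<comment> \<open>The raw index \<open>j\<close> in \<open>Xb j\<close> may differ from
    \<open>i\<close> by a multiple of \<open>2n\<close>, and \<open>\<beta>\<close> does not see
    this.\<close>
  have hb [simp]: "h (b_elem n i) = \<beta> i" for i
  proof -
    obtain j where j: "b_elem n i = Xb j" "b_elem n j = b_elem n i"
      by (cases n) (auto simp: mod_eq_dvd_iff)
    then have "\<beta> j = \<beta> i" using \<beta>_iff by blast
    then show ?thesis by (simp add: j h_def)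
  qed
  have "has_subalgebra_iso S (X_alg n)"
  proof (rule has_subalgebra_isoI[of h])
    show "h ` carrier (X_alg n) \<subseteq> carrier S" using n0 by (auto simp: carrier_X_alg)
    \<comment> \<open>Meets with \<open>b\<close> separate the classes:
      \<open>\<beta> i \<sqinter> b = \<beta> i\<close> fails for the upper elements, and
      \<open>b \<sqinter> \<beta> i = b\<close> fails for the lower ones.\<close>
    have ne: "a1 \<noteq> \<beta> i" "a2 \<noteq> \<beta> i" "c1 \<noteq> \<beta> i" "c2 \<noteq> \<beta> i" for i
      using ab_ne bc_ne \<beta>_mid(2,3)[of i] by metis+
    have "a1 \<noteq> c1" "a1 \<noteq> c2" "a2 \<noteq> c1" "a2 \<noteq> c2" using ab_ne cb by metis+
    then show "inj_on h (carrier (X_alg n))"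
      using n0 ne[THEN not_sym] ne a12 c12
      by (auto simp: inj_on_def carrier_X_alg \<beta>_iff)
    fix x y assume xy: "x \<in> carrier (X_alg n)" "y \<in> carrier (X_alg n)"
    have "h (X_join n x y) = h x \<squnion> h y \<and> h (X_meet n x y) = h x \<sqinter> h y"
      by (rule X_alg_cases[OF xy(1) n0]; rule X_alg_cases[OF xy(2) n0])
        (simp_all add: X_ops \<beta>_a \<beta>_c a\<beta> \<beta>c c\<beta> ca \<beta>a \<beta>\<beta>
          join_eq_right_iff[THEN iffD2] join_eq_left_iff[THEN iffD2] del: b_elem.simps)
    then show "x \<squnion>\<^bsub>X_alg n\<^esub> y \<in> carrier (X_alg n) \<and> x \<sqinter>\<^bsub>X_alg n\<^esub> y \<in> carrier (X_alg n) \<and>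
      h (x \<squnion>\<^bsub>X_alg n\<^esub> y) = h x \<squnion> h y \<and> h (x \<sqinter>\<^bsub>X_alg n\<^esub> y) = h x \<sqinter> h y"
      using X_alg_closed[OF xy n0] by simp
  qed
  then show ?thesis using n2 by blast
qed

end

section \<open>Forbidden subalgebras\<close>

text \<open>The image of a_2 is b_2 and the preimage of c_2 is b_0; they differ because 2 is not
  divisible by \<open>2n\<close> for finite \<open>n \<ge> 2\<close>.\<close>

lemma bad_chain_X_alg:
  assumes "2 \<le> n"
  shows "bad_chain (X_alg n) Xa1 (b_elem n 1) Xc1 Xa2 Xc2"
proof -
  have n0: "n \<noteq> 0" using assms by auto
  have "b_elem n 2 \<noteq> b_elem n 0"
  proof (cases n)
    case (enat m)
    then have "m \<ge> 2" using assms by (simp add: numeral_eq_enat)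
    then show ?thesis using zdvd_imp_le[of "2 * int m" 2] unfolding enat b_elem_finite_eq_iff by auto
  qed simp
  then show ?thesis
    using n0 by (simp add: bad_chain_def nat_ge_def carrier_X_alg X_ops del: b_elem.simps)
qed

lemma bad_chain_subalgebra:
  assumes "has_subalgebra_iso S X" "bad_chain X a b c a' c'"
  shows "\<exists>a b c a' c'. bad_chain S a b c a' c'"
proof -
  obtain g where g: "inj_on g (carrier X)" "g ` carrier X \<subseteq> carrier S"
    "\<And>x y. x \<in> carrier X \<Longrightarrow> y \<in> carrier X \<Longrightarrow> x \<squnion>\<^bsub>X\<^esub> y \<in> carrier X \<and> x \<sqinter>\<^bsub>X\<^esub> y \<in> carrier X"
    "\<And>x y. x \<in> carrier X \<Longrightarrow> y \<in> carrier X \<Longrightarrow> g (x \<squnion>\<^bsub>X\<^esub> y) = g x \<squnion>\<^bsub>S\<^esub> g y"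
    "\<And>x y. x \<in> carrier X \<Longrightarrow> y \<in> carrier X \<Longrightarrow> g (x \<sqinter>\<^bsub>X\<^esub> y) = g x \<sqinter>\<^bsub>S\<^esub> g y"
    using has_subalgebra_isoE[OF assms(1)] by blast
  note X = assms(2)[unfolded bad_chain_def nat_ge_def]
  have [simp]: "a \<in> carrier X" "b \<in> carrier X" "c \<in> carrier X" "a' \<in> carrier X" "c' \<in> carrier X"
    using X by auto
  have "g a \<squnion>\<^bsub>S\<^esub> g b = g a" "g b \<squnion>\<^bsub>S\<^esub> g a = g a" "g b \<squnion>\<^bsub>S\<^esub> g c = g b" "g c \<squnion>\<^bsub>S\<^esub> g b = g b"
    using X by (simp_all add: g(4)[symmetric])
  moreover have "g c' \<squnion>\<^bsub>S\<^esub> g a \<squnion>\<^bsub>S\<^esub> g c' = g a'" "g a' \<sqinter>\<^bsub>S\<^esub> g c \<sqinter>\<^bsub>S\<^esub> g a' = g c'"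
    using X by (simp_all add: g(4,5)[symmetric] g(3))
  moreover have "g a' \<sqinter>\<^bsub>S\<^esub> g b \<sqinter>\<^bsub>S\<^esub> g a' \<noteq> g c' \<squnion>\<^bsub>S\<^esub> g b \<squnion>\<^bsub>S\<^esub> g c'"
    using X inj_onD[OF g(1), of "a' \<sqinter>\<^bsub>X\<^esub> b \<sqinter>\<^bsub>X\<^esub> a'" "c' \<squnion>\<^bsub>X\<^esub> b \<squnion>\<^bsub>X\<^esub> c'"]
    by (auto simp: g(4,5)[symmetric] g(3))
  ultimately have "bad_chain S (g a) (g b) (g c) (g a') (g c')"
    using g(2) unfolding bad_chain_def nat_ge_def by auto
  then show ?thesis by blast
qed

text \<open>Stated for plain records, where dualizing twice gives back \<open>S\<close>.\<close>

lemma has_Y_alg_iff: "has_subalgebra_iso S (Y_alg n) \<longleftrightarrow> has_subalgebra_iso (dual_alg S) (X_alg n)"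
  for S :: "'a skew_alg"
  using has_subalgebra_iso_dual[of S "Y_alg n"] has_subalgebra_iso_dual[of "dual_alg S" "X_alg n"]
  by (auto simp: Y_alg_eq_dual dual_dual_alg)

theorem skew_lattice_categorical_iff:
  fixes S :: "'a skew_alg"
  assumes "skew_lattice S"
  shows "categorical S \<longleftrightarrow> (\<forall>n. 2 \<le> n \<longrightarrow>
    \<not> has_subalgebra_iso S (X_alg n) \<and> \<not> has_subalgebra_iso S (Y_alg n))"
proof -
  interpret skew_lattice S by fact
  interpret d: skew_lattice "dual_alg S" by (rule dual_skew_lattice)
  have "(\<exists>a b c a' c'. bad_chain S a b c a' c') \<longleftrightarrow>
      (\<exists>n\<ge>2. has_subalgebra_iso S (X_alg n) \<or> has_subalgebra_iso (dual_alg S) (X_alg n))"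
  proof
    assume "\<exists>a b c a' c'. bad_chain S a b c a' c'"
    then show "\<exists>n\<ge>2. has_subalgebra_iso S (X_alg n) \<or> has_subalgebra_iso (dual_alg S) (X_alg n)"
      using left_bad_chain_cases left_bad_chain_embeds d.left_bad_chain_embeds by meson
  next
    assume "\<exists>n\<ge>2. has_subalgebra_iso S (X_alg n) \<or> has_subalgebra_iso (dual_alg S) (X_alg n)"
    then obtain n :: enat where "n \<ge> 2" and
      *: "has_subalgebra_iso S (X_alg n) \<or> has_subalgebra_iso (dual_alg S) (X_alg n)" by blast
    note bad = bad_chain_X_alg[OF \<open>n \<ge> 2\<close>]
    from * show "\<exists>a b c a' c'. bad_chain S a b c a' c'"
    proof
      assume "has_subalgebra_iso (dual_alg S) (X_alg n)"
      from bad_chain_subalgebra[OF this bad] show ?thesis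
        using d.bad_chain_dual by (metis dual_dual_alg)
    qed (rule bad_chain_subalgebra[OF _ bad])
  qed
  then show ?thesis unfolding categorical_iff has_Y_alg_iff by blast
qed

section \<open>Separating the algebras X_n and Y_n from each other\<close>

lemma a_mem_X_alg: "Xa1 \<in> carrier (X_alg n)" "Xa2 \<in> carrier (X_alg n)"
  by (simp_all add: X_alg_def)

text \<open>In Y_n the meet of a_1 and a_2 is the right factor; left-handedness would then identify
  their images.\<close>

lemma (in left_handed_skew_lattice) no_Y_alg:
  "\<not> has_subalgebra_iso S (Y_alg n)"
proof
  assume "has_subalgebra_iso S (Y_alg n)"
  then obtain g where g: "inj_on g (carrier (X_alg n))" "g ` carrier (X_alg n) \<subseteq> carrier S"
    "\<And>x y. x \<in> carrier (X_alg n) \<Longrightarrow> y \<in> carrier (X_alg n) \<Longrightarrow> g (X_meet n y x) = g x \<sqinter> g y"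
    by (rule has_subalgebra_isoE) (auto simp: Y_alg_eq_dual)
  have c: "g Xa1 \<in> carrier S" "g Xa2 \<in> carrier S" using g(2) a_mem_X_alg[of n] by auto
  have "g Xa1 \<sqinter> g Xa2 = g Xa2" "g Xa2 \<sqinter> g Xa1 = g Xa1"
    using a_mem_X_alg[of n] by (simp_all add: g(3)[symmetric] X_ops)
  then have "g Xa1 = g Xa2" using left_handed_meet[OF c] by simp
  then show False using inj_onD[OF g(1)] a_mem_X_alg[of n] by fastforce
qed

lemma (in right_handed_skew_lattice) no_X_alg:
  "\<not> has_subalgebra_iso S (X_alg n)"
proof
  assume "has_subalgebra_iso S (X_alg n)"
  then obtain g where g: "inj_on g (carrier (X_alg n))" "g ` carrier (X_alg n) \<subseteq> carrier S"
    "\<And>x y. x \<in> carrier (X_alg n) \<Longrightarrow> y \<in> carrier (X_alg n) \<Longrightarrow> g (X_meet n x y) = g x \<sqinter> g y"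
    by (rule has_subalgebra_isoE) auto
  have c: "g Xa1 \<in> carrier S" "g Xa2 \<in> carrier S" using g(2) a_mem_X_alg[of n] by auto
  have "g Xa1 \<sqinter> g Xa2 = g Xa1" "g Xa2 \<sqinter> g Xa1 = g Xa2"
    using a_mem_X_alg[of n] by (simp_all add: g(3)[symmetric] X_ops)
  then have "g Xa1 = g Xa2" using right_handed_meet[OF c] c by simp
  then show False using inj_onD[OF g(1)] a_mem_X_alg[of n] by fastforce
qed

lemma class_gt_asym: "class_gt x y \<Longrightarrow> \<not> class_gt y x"
  by (cases x; cases y) simp_all

text \<open>Argued on the operation table: for two elements of X_n the class order holds in at most
  one direction, so some meet of the two returns its left factor. Reversed meets of the images of
  a_1 and a_2 would both return the right one.\<close>

lemma Y_alg_no_X_alg: "\<not> has_subalgebra_iso (Y_alg n) (X_alg m)"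
proof
  assume "has_subalgebra_iso (Y_alg n) (X_alg m)"
  then obtain g where g: "inj_on g (carrier (X_alg m))"
    "\<And>x y. x \<in> carrier (X_alg m) \<Longrightarrow> y \<in> carrier (X_alg m) \<Longrightarrow> g (X_meet m x y) = X_meet n (g y) (g x)"
    by (rule has_subalgebra_isoE) (auto simp: Y_alg_eq_dual)
  have "X_meet n (g Xa2) (g Xa1) = g Xa1" "X_meet n (g Xa1) (g Xa2) = g Xa2"
    using a_mem_X_alg[of m] by (simp_all add: g(2)[symmetric] X_ops)
  then have "g Xa1 = g Xa2" using class_gt_asym X_meet_class by metis
  then show False using inj_onD[OF g(1)] a_mem_X_alg[of m] by fastforce
qed

text \<open>The cardinality determines \<open>n\<close>, since the value 0 of \<open>card\<close> on
  infinite sets differs from every \<open>2 * m + 4\<close>.\<close>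

lemma card_X_alg: "card (carrier (X_alg n)) = (case n of enat m \<Rightarrow> 2 * m + 4 | \<infinity> \<Rightarrow> 0)"
proof (cases n)
  case (enat m)
  have "carrier (X_alg n) = insert Xa1 (insert Xa2 (insert Xc1 (insert Xc2 (Xb ` {1..2 * int m}))))"
    by (auto simp: X_alg_def enat)
  moreover have "card (Xb ` {1..2 * int m}) = 2 * m"
    by (subst card_image) (auto simp: inj_on_def)
  ultimately show ?thesis by (simp add: enat card_insert_if image_iff)
next
  case infinity
  have "infinite (range Xb)" using finite_imageD[of Xb UNIV] infinite_UNIV_int by (auto simp: inj_on_def)
  moreover have "range Xb \<subseteq> carrier (X_alg n)" by (auto simp: X_alg_def infinity)
  ultimately have "infinite (carrier (X_alg n))" by (rule infinite_super[rotated])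
  then show ?thesis by (simp add: infinity)
qed

text \<open>A copy of \<open>X\<^sub>m\<close> in \<open>X\<^sub>n\<close> contains \<open>a\<^sub>1, a\<^sub>2, c\<^sub>1, c\<^sub>2\<close> and some \<open>b\<^sub>i\<close>, from which these four
  elements generate all neighbours \<open>b\<^sub>i\<^sub>+\<^sub>1\<close> and \<open>b\<^sub>i\<^sub>-\<^sub>1\<close>. So it is all of \<open>X\<^sub>n\<close>.\<close>

lemma X_alg_no_proper_X_alg:
  assumes "has_subalgebra_iso (X_alg n) (X_alg m)" and n: "2 \<le> n" and m: "2 \<le> m"
  shows "m = n"
proof -
  have n0: "n \<noteq> 0" and m0: "m \<noteq> 0" using n m by auto
  obtain g where g: "inj_on g (carrier (X_alg m))" "g ` carrier (X_alg m) \<subseteq> carrier (X_alg n)"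
    "\<And>x y. x \<in> carrier (X_alg m) \<Longrightarrow> y \<in> carrier (X_alg m) \<Longrightarrow> g (X_join m x y) = X_join n (g x) (g y)"
    "\<And>x y. x \<in> carrier (X_alg m) \<Longrightarrow> y \<in> carrier (X_alg m) \<Longrightarrow> g (X_meet m x y) = X_meet n (g x) (g y)"
    using assms(1) by (rule has_subalgebra_isoE) auto
  define T where "T = g ` carrier (X_alg m)"
  have closed: "X_join n x y \<in> T" "X_meet n x y \<in> T" if "x \<in> T" "y \<in> T" for x y
    using that unfolding T_def
    by (auto simp: g(3,4)[symmetric] X_alg_closed[OF _ _ m0])
  \<comment> \<open>Where the class of the left factor is not greater, \<open>X_meet\<close> is the
    left projection; a meet equal to a different right factor therefore shows strictly ordered
    classes.\<close>
  have gt: "class_gt (class_of (g x)) (class_of (g y))"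
    if "x \<in> carrier (X_alg m)" "y \<in> carrier (X_alg m)" "X_meet m x y = y" "x \<noteq> y" for x y
    using g(4)[OF that(1,2)] that inj_onD[OF g(1), of x y] X_meet_class[of "g x" "g y" n] by metis
  have mem: "Xa1 \<in> carrier (X_alg m)" "Xa2 \<in> carrier (X_alg m)" "b_elem m i \<in> carrier (X_alg m)"
    "Xc1 \<in> carrier (X_alg m)" "Xc2 \<in> carrier (X_alg m)" for i
    using m0 by (simp_all add: carrier_X_alg)
  have b_ne: "b_elem m i \<notin> {Xa1, Xa2, Xc1, Xc2}" for i
    using class_of_b_elem[of m i] by (auto simp del: class_of_b_elem b_elem.simps)
  have "class_gt (class_of (g Xa1)) (class_of (g (b_elem m 1)))"
    "class_gt (class_of (g Xa2)) (class_of (g (b_elem m 2)))"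
    "class_gt (class_of (g (b_elem m 1))) (class_of (g Xc1))"
    "class_gt (class_of (g (b_elem m 2))) (class_of (g Xc2))"
    using b_ne[of 1] b_ne[of 2] by (auto intro!: gt mem simp: X_ops simp del: b_elem.simps)
  \<comment> \<open>Three classes admit one strict chain of length three, so the embedding preserves
    the classes.\<close>
  moreover have chain: "x = ClassA \<and> y = ClassB \<and> z = ClassC" if "class_gt x y" "class_gt y z" for x y z
    using that by (cases x; cases y; cases z) simp_all
  ultimately have cl: "class_of (g Xa1) = ClassA" "class_of (g Xa2) = ClassA"
    "class_of (g (b_elem m 1)) = ClassB" "class_of (g Xc1) = ClassC" "class_of (g Xc2) = ClassC"
    by blast+
  have A: "x \<in> {Xa1, Xa2}" if "class_of x = ClassA" for x using that by (cases x) simp_all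
  have C: "x \<in> {Xc1, Xc2}" if "class_of x = ClassC" for x using that by (cases x) simp_all
  have "g Xa1 \<noteq> g Xa2" "g Xc1 \<noteq> g Xc2"
    using inj_onD[OF g(1) _ mem(1,2)] inj_onD[OF g(1) _ mem(4,5)] by auto
  then have "{Xa1, Xa2, Xc1, Xc2} \<subseteq> {g Xa1, g Xa2, g Xc1, g Xc2}"
    using A[OF cl(1)] A[OF cl(2)] C[OF cl(4)] C[OF cl(5)] by auto
  moreover have "{g Xa1, g Xa2, g Xc1, g Xc2} \<subseteq> T" using mem(1,2,4,5) unfolding T_def by blast
  ultimately have acT: "{Xa1, Xa2, Xc1, Xc2} \<subseteq> T" by (rule subset_trans)
  have "g (b_elem m 1) \<in> carrier (X_alg n)" using g(2) mem(3)[of 1] by blast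
  then obtain i0 where "g (b_elem m 1) = b_elem n i0"
    using cl(3) n0 by (auto simp: carrier_X_alg simp del: b_elem.simps)
  then have i0: "b_elem n i0 \<in> T" using mem(3)[of 1] unfolding T_def by (metis imageI)
  have up: "b_elem n (i + 1) \<in> T" and down: "b_elem n (i - 1) \<in> T" if "b_elem n i \<in> T" for i
    using closed(2)[OF _ that, of Xa1] closed(2)[OF _ that, of Xa2] closed(1)[OF that, of Xc1]
      closed(1)[OF that, of Xc2] acT by (cases "even i"; simp add: X_ops del: b_elem.simps)+
  have "b_elem n i \<in> T" for i
    using i0 by (induction i rule: int_induct[where k = i0]) (simp_all add: up down)
  then have "T = carrier (X_alg n)"
    using acT g(2) n0 by (auto simp: carrier_X_alg T_def)
  then have "card (carrier (X_alg n)) = card (carrier (X_alg m))"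
    using card_image[OF g(1)] by (simp add: T_def)
  then show ?thesis by (auto simp: card_X_alg split: enat.splits)
qed

theorem theorem3p3:
  "(\<forall>S :: 'a skew_alg. left_handed_skew_lattice S \<longrightarrow>
      (categorical S \<longleftrightarrow> (\<forall>n :: enat. 2 \<le> n \<longrightarrow> \<not> has_subalgebra_iso S (X_alg n)))) \<and>
   (\<forall>S :: 'a skew_alg. right_handed_skew_lattice S \<longrightarrow>
      (categorical S \<longleftrightarrow> (\<forall>n :: enat. 2 \<le> n \<longrightarrow> \<not> has_subalgebra_iso S (Y_alg n)))) \<and>
   (\<forall>S :: 'a skew_alg. skew_lattice S \<longrightarrow>
      (categorical S \<longleftrightarrow>
        (\<forall>n :: enat. 2 \<le> n \<longrightarrow>
          \<not> has_subalgebra_iso S (X_alg n) \<and> \<not> has_subalgebra_iso S (Y_alg n)))) \<and>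
   (\<forall>m n :: enat. 2 \<le> m \<longrightarrow> 2 \<le> n \<longrightarrow>
      (m \<noteq> n \<longrightarrow> \<not> has_subalgebra_iso (X_alg n) (X_alg m)) \<and>
      (m \<noteq> n \<longrightarrow> \<not> has_subalgebra_iso (Y_alg n) (Y_alg m)) \<and>
      \<not> has_subalgebra_iso (Y_alg n) (X_alg m) \<and>
      \<not> has_subalgebra_iso (X_alg n) (Y_alg m))"
proof (intro conjI allI impI)
  fix S :: "'a skew_alg"
  show "categorical S \<longleftrightarrow> (\<forall>n :: enat. 2 \<le> n \<longrightarrow> \<not> has_subalgebra_iso S (X_alg n))"
    if "left_handed_skew_lattice S"
    using skew_lattice_categorical_iff[OF left_handed_skew_lattice.axioms(1)[OF that]]
      left_handed_skew_lattice.no_Y_alg[OF that] by blast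
  show "categorical S \<longleftrightarrow> (\<forall>n :: enat. 2 \<le> n \<longrightarrow> \<not> has_subalgebra_iso S (Y_alg n))"
    if "right_handed_skew_lattice S"
    using skew_lattice_categorical_iff[OF right_handed_skew_lattice.axioms(1)[OF that]]
      right_handed_skew_lattice.no_X_alg[OF that] by blast
  show "categorical S \<longleftrightarrow> (\<forall>n :: enat. 2 \<le> n \<longrightarrow>
      \<not> has_subalgebra_iso S (X_alg n) \<and> \<not> has_subalgebra_iso S (Y_alg n))"
    if "skew_lattice S"
    using that by (rule skew_lattice_categorical_iff)
next
  fix m n :: enat assume *: "2 \<le> m" "2 \<le> n"
  show "\<not> has_subalgebra_iso (X_alg n) (X_alg m)" if "m \<noteq> n"
    using X_alg_no_proper_X_alg * that by blast
  show "\<not> has_subalgebra_iso (Y_alg n) (Y_alg m)" if "m \<noteq> n"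
    using X_alg_no_proper_X_alg * that by (auto simp: has_Y_alg_iff Y_alg_eq_dual[of n] dual_dual_alg)
  show "\<not> has_subalgebra_iso (Y_alg n) (X_alg m)" by (rule Y_alg_no_X_alg)
  show "\<not> has_subalgebra_iso (X_alg n) (Y_alg m)"
    using Y_alg_no_X_alg[of n m] unfolding has_Y_alg_iff by (simp add: Y_alg_eq_dual)
qed

end
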